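(* Let $m,n\ge1$ be integers, let $1<p_i<\infty$ for $i=1,\dots,m$, and let $\frac1p=\frac1{p_1}+\dots+\frac1{p_m}$. For each $i=1,\dots,m$ let $X_i$ be a Banach function space over $\mathbb R^n$ (with Lebesgue measure) such that the maximal operator $M_{X_i'}$ is bounded on $L^{p_i}(\mathbb R^n)$. Let $u$ and $v_1,\dots,v_m$ be weights satisfying $$K=\sup_Q\Big(\frac{u(Q)}{|Q|}\Big)^{\frac1p}\prod_{i=1}^m\|v_i^{-1/p_i}\|_{X_i,Q}<\infty,$$ the supremum over all cubes $Q\subset\mathbb R^n$. Then for every $\vec f=(f_1,\dots,f_m)$ with measurable entries, $$\|\mathcal M(\vec f\,)\|_{L^p(u)}\le C_{n,m}\,K\prod_{i=1}^m\|M_{X_i'}\|_{L^{p_i}(\mathbb R^n)}\|f_i\|_{L^{p_i}(v_i)},$$ where $C_{n,m}$ depends only on $n$ and $m$.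
   Context: Cubes in $\mathbb R^n$ have sides parallel to the axes. Weights are non-negative measurable functions, with $0<v_i<\infty$ a.e.; $u(Q)=\int_Q u$ and $\|f\|_{L^q(w)}=(\int_{\mathbb R^n}|f|^q w)^{1/q}$ for $0<q<\infty$. The multi(sub)linear maximal operator is $\mathcal M(\vec f\,)(x)=\sup_{Q\ni x}\prod_{i=1}^m\frac1{|Q|}\int_Q|f_i(y_i)|\,dy_i$, the supremum over all cubes $Q$ containing $x$. Banach function spaces are understood in the sense of Bennett–Sharpley. The associate space $X'$ of a Banach function space $X$ consists of the measurable $f$ with $\|f\|_{X'}=\sup_{\|g\|_X\le1}\int_{\mathbb R^n}|f(x)g(x)|\,dx<\infty$. For a cube $Q$ of side length $\ell_Q$, the $X$-average of $f$ over $Q$ and the maximal operator $M_X$ are $$\|f\|_{X,Q}=\|\tau_{\ell_Q}(f\chi_Q)\|_X,\qquad M_Xf(x)=\sup_{Q\ni x}\|f\|_{X,Q},$$ where $\tau_\delta f(x)=f(\delta x)$ for $\delta>0$, $x\in\mathbb R^n$. $\|M_{X_i'}\|_{L^{p_i}(\mathbb R^n)}$ denotes the operator norm of $M_{X_i'}$ on $L^{p_i}(\mathbb R^n)$, i.e. the least $N$ with $\|M_{X_i'}f\|_{L^{p_i}}\le N\|f\|_{L^{p_i}}$ for all $f$. *)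

theory Defs
  imports "HOL-Analysis.Analysis"
begin

text \<open>
  All nonnegative functions (weights, maximal functions, moduli of functions) are
  \<open>[0,\<infinity>]\<close>-valued and measurable means Lebesgue measurable.
  Products follow the convention \<open>0 \<cdot> \<infinity> = 0\<close> of type \<open>ennreal\<close>.
\<close>

definition epowr :: "ennreal \<Rightarrow> real \<Rightarrow> ennreal" (infixr "epowr" 80) where
  "x epowr a =
    (if a = 0 then 1
     else if x = 0 then (if a < 0 then \<infinity> else 0)
     else if x = \<infinity> then (if a < 0 then 0 else \<infinity>)
     else ennreal (enn2real x powr a))"

abbreviation modulus :: "('a \<Rightarrow> real) \<Rightarrow> 'a \<Rightarrow> ennreal" where
  "modulus f \<equiv> (\<lambda>x. ennreal \<bar>f x\<bar>)"

text \<open>The (closed) cube with lower corner \<open>a\<close> and side length \<open>l\<close>; it is used for \<open>l > 0\<close> only.\<close>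

definition cube :: "real ^ 'n \<Rightarrow> real \<Rightarrow> (real ^ 'n) set" where
  "cube a l = cbox a (\<chi> i. a $ i + l)"

text \<open>The norm of \<open>L\<^sup>q(w)\<close>, applied to \<open>|f|\<close>; it is a quasi-norm if \<open>q < 1\<close>.\<close>

definition Lnorm :: "real \<Rightarrow> (real ^ 'n \<Rightarrow> ennreal) \<Rightarrow> (real ^ 'n \<Rightarrow> ennreal) \<Rightarrow> ennreal" where
  "Lnorm q w g = (\<integral>\<^sup>+ x. g x epowr q * w x \<partial>lebesgue) epowr (1 / q)"

definition mean :: "(real ^ 'n \<Rightarrow> ennreal) \<Rightarrow> (real ^ 'n) set \<Rightarrow> ennreal" where
  "mean g Q = (\<integral>\<^sup>+ x\<in>Q. g x \<partial>lebesgue) / emeasure lebesgue Q"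

definition multi_maximal :: "nat \<Rightarrow> (nat \<Rightarrow> real ^ 'n \<Rightarrow> real) \<Rightarrow> real ^ 'n \<Rightarrow> ennreal" where
  "multi_maximal m f x =
    (SUP (a, l) \<in> {(a, l). 0 < l \<and> x \<in> cube a l}. \<Prod>i = 1..m. mean (modulus (f i)) (cube a l))"

text \<open>
  Banach function norms in the sense of Bennett and Sharpley, axioms (P1)--(P5). The Banach
  function space \<open>X\<close> is represented by its function norm \<open>\<rho>\<close>: \<open>X\<close> consists
  of the measurable \<open>f\<close> with \<open>\<rho> |f| < \<infinity>\<close>, and \<open>\<rho> |f|\<close> is its norm there. The
  values of \<open>\<rho>\<close> on non-measurable functions are irrelevant.
\<close>

locale banach_function_norm =
  fixes \<rho> :: "(real ^ 'n \<Rightarrow> ennreal) \<Rightarrow> ennreal"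
  assumes zero_iff: "f \<in> borel_measurable lebesgue \<Longrightarrow>
      \<rho> f = 0 \<longleftrightarrow> (AE x in lebesgue. f x = 0)"
    and scale: "f \<in> borel_measurable lebesgue \<Longrightarrow> 0 \<le> c \<Longrightarrow>
      \<rho> (\<lambda>x. ennreal c * f x) = ennreal c * \<rho> f"
    and triangle: "f \<in> borel_measurable lebesgue \<Longrightarrow> g \<in> borel_measurable lebesgue \<Longrightarrow>
      \<rho> (\<lambda>x. f x + g x) \<le> \<rho> f + \<rho> g"
    and mono_AE: "f \<in> borel_measurable lebesgue \<Longrightarrow> g \<in> borel_measurable lebesgue \<Longrightarrow>
      (AE x in lebesgue. g x \<le> f x) \<Longrightarrow> \<rho> g \<le> \<rho> f"
    and fatou: "(\<And>k::nat. F k \<in> borel_measurable lebesgue) \<Longrightarrow> f \<in> borel_measurable lebesgue \<Longrightarrow>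
      (AE x in lebesgue. incseq (\<lambda>k. F k x) \<and> (SUP k. F k x) = f x) \<Longrightarrow>
      (SUP k. \<rho> (F k)) = \<rho> f"
    and indicator_finite: "E \<in> sets lebesgue \<Longrightarrow> emeasure lebesgue E < \<infinity> \<Longrightarrow>
      \<rho> (indicator E) < \<infinity>"
    and integral_bound: "E \<in> sets lebesgue \<Longrightarrow> emeasure lebesgue E < \<infinity> \<Longrightarrow>
      \<exists>c::real. \<forall>f \<in> borel_measurable lebesgue. (\<integral>\<^sup>+ x\<in>E. f x \<partial>lebesgue) \<le> ennreal c * \<rho> f"

definition associate ::
    "((real ^ 'n \<Rightarrow> ennreal) \<Rightarrow> ennreal) \<Rightarrow> (real ^ 'n \<Rightarrow> ennreal) \<Rightarrow> ennreal" where
  "associate \<rho> f =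
    (SUP g \<in> {g \<in> borel_measurable lebesgue. \<rho> g \<le> 1}. \<integral>\<^sup>+ x. f x * g x \<partial>lebesgue)"

definition cube_average ::
    "((real ^ 'n \<Rightarrow> ennreal) \<Rightarrow> ennreal) \<Rightarrow> real ^ 'n \<Rightarrow> real \<Rightarrow> (real ^ 'n \<Rightarrow> ennreal) \<Rightarrow> ennreal" where
  "cube_average \<rho> a l f = \<rho> (\<lambda>x. f (l *\<^sub>R x) * indicator (cube a l) (l *\<^sub>R x))"

definition maximal ::
    "((real ^ 'n \<Rightarrow> ennreal) \<Rightarrow> ennreal) \<Rightarrow> (real ^ 'n \<Rightarrow> ennreal) \<Rightarrow> real ^ 'n \<Rightarrow> ennreal" where
  "maximal \<rho> f x = (SUP (a, l) \<in> {(a, l). 0 < l \<and> x \<in> cube a l}. cube_average \<rho> a l f)"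

text \<open>The norm on \<open>L\<^sup>q\<close> of the maximal operator of \<open>\<rho>\<close>; it is \<open>\<infinity>\<close> iff the operator is unbounded.\<close>

definition maximal_opnorm :: "((real ^ 'n \<Rightarrow> ennreal) \<Rightarrow> ennreal) \<Rightarrow> real \<Rightarrow> ennreal" where
  "maximal_opnorm \<rho> q = Inf {N. \<forall>f :: real ^ 'n \<Rightarrow> real. f \<in> borel_measurable lebesgue \<longrightarrow>
      Lnorm q (\<lambda>_. 1) (maximal \<rho> (modulus f)) \<le> N * Lnorm q (\<lambda>_. 1) (modulus f)}"

definition weight_constant ::
    "nat \<Rightarrow> real \<Rightarrow> (nat \<Rightarrow> real) \<Rightarrow> (nat \<Rightarrow> (real ^ 'n \<Rightarrow> ennreal) \<Rightarrow> ennreal) \<Rightarrow>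
      (real ^ 'n \<Rightarrow> ennreal) \<Rightarrow> (nat \<Rightarrow> real ^ 'n \<Rightarrow> ennreal) \<Rightarrow> ennreal" where
  "weight_constant m p ps X u v =
    (SUP (a, l) \<in> {(a, l). 0 < l}.
      mean u (cube a l) epowr (1 / p) *
      (\<Prod>i = 1..m. cube_average (X i) a l (\<lambda>x. v i x epowr (- 1 / ps i))))"

end

theory Submission
  imports Defs
begin

text \<open>
  Write \<open>A(Q)\<close> for the product over \<open>i\<close> of the means of \<open>|f\<^sub>i|\<close> over a cube \<open>Q\<close>, and put
  \<open>h\<^sub>i = |f\<^sub>i| v\<^sub>i\<^bsup>1/p\<^sub>i\<^esup>\<close>, so that the norm of \<open>h\<^sub>i\<close> in \<open>L\<^bsup>p\<^sub>i\<^esup>\<close> is the norm of \<open>f\<^sub>i\<close> in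
  \<open>L\<^bsup>p\<^sub>i\<^esup>(v\<^sub>i)\<close>. Hoelder's inequality between \<open>X\<^sub>i\<close> and its associate space, dilated to \<open>Q\<close>, bounds the
  mean of \<open>|f\<^sub>i|\<close> by \<open>G\<^sub>i(Q) W\<^sub>i(Q)\<close>, where \<open>G\<^sub>i(Q)\<close> is the average of \<open>h\<^sub>i\<close> with respect to the associate
  space and \<open>W\<^sub>i(Q)\<close> is the \<open>X\<^sub>i\<close>-average of \<open>v\<^sub>i\<^bsup>-1/p\<^sub>i\<^esup>\<close>. The weight condition absorbs \<open>u\<close> together
  with the \<open>W\<^sub>i\<close>: \<open>A(Q)\<^sup>p u(Q) \<le> K\<^sup>p |Q| \<Prod>\<^sub>i G\<^sub>i(Q)\<^sup>p\<close>.

  Such bounds can be summed over a family of cubes that own disjoint sets \<open>E(Q)\<close> of measure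
  comparable to \<open>|Q|\<close>. The discrete Hoelder inequality with exponents \<open>p/p\<^sub>i\<close> then leaves
  \<open>\<Sum>\<^sub>Q |E(Q)| G\<^sub>i(Q)\<^bsup>p\<^sub>i\<^esup>\<close>, which is at most the integral of the \<open>p\<^sub>i\<close>-th power of the maximal function
  of \<open>h\<^sub>i\<close>, because \<open>G\<^sub>i(Q)\<close> is at most that maximal function everywhere on \<open>Q\<close>.

  It remains to dominate the maximal function of a finite family of cubes by a family of this kind.
  This is done without dyadic grids (\<open>sparse_selection\<close>): go through the cubes in decreasing size and
  discard \<open>R\<close> if a cube \<open>P\<close> selected before meets \<open>R\<close> and satisfies \<open>A(R) \<le> \<kappa> A(3P)\<close>. A discarded
  cube lies in \<open>3P\<close>, so the tripled selected cubes control everything. If \<open>R\<close> is selected although it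
  meets \<open>P\<close>, then \<open>A(R) > \<kappa> A(3P)\<close>; by a Vitali covering and Hoelder's inequality with exponents
  \<open>1/m\<close>, such cubes cover at most half of \<open>P\<close> once \<open>\<kappa> = (2 \<cdot> 9\<^sup>n)\<^sup>m\<close>. The rest of \<open>P\<close> serves as the
  disjoint set \<open>E(P)\<close>.

  All cubes are reached from finite families by enlarging every cube to one with rational data, at the
  cost of a factor \<open>2\<^bsup>nm\<^esup>\<close>, and by monotone convergence. Maximal functions are only
  compared pointwise with measurable functions built from countably many cubes, so that nothing but the
  monotonicity of the integral is applied to them. The factor \<open>(2 \<cdot> 3\<^sup>n)\<^bsup>1/p\<^esup>\<close> from the measures of \<open>E(P)\<close> and \<open>3P\<close> is bounded uniformly
  in the exponents since \<open>1/p \<le> m\<close>.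
\<close>

section \<open>Powers in \<open>[0,\<infinity>]\<close> and the discrete Hoelder inequality\<close>

lemma epowr_mono:
  assumes "0 < a" "x \<le> y"
  shows "x epowr a \<le> y epowr a"
  using assms unfolding epowr_def
  by (auto intro!: ennreal_leI powr_mono2 enn2real_mono simp: top_unique less_top[symmetric])

lemma epowr_one [simp]: "x epowr 1 = x"
  by (cases x) (auto simp: epowr_def)

lemma zero_epowr [simp]: "0 < a \<Longrightarrow> 0 epowr a = 0"
  by (simp add: epowr_def)

lemma top_epowr [simp]: "0 < a \<Longrightarrow> top epowr a = top"
  by (simp add: epowr_def)

lemma ennreal_epowr:
  assumes "0 < a" "0 \<le> r"
  shows "ennreal r epowr a = ennreal (r powr a)"
  using assms by (auto simp: epowr_def)

lemma epowr_eq_0_iff: "0 < a \<Longrightarrow> x epowr a = 0 \<longleftrightarrow> x = 0"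
  by (cases x) (auto simp: epowr_def ennreal_eq_0_iff not_le)

lemma epowr_eq_top_iff: "0 < a \<Longrightarrow> x epowr a = top \<longleftrightarrow> x = top"
  by (cases x) (auto simp: epowr_def)

lemma epowr_pos: "0 < x \<Longrightarrow> x < \<infinity> \<Longrightarrow> 0 < x epowr a"
  by (cases x) (auto simp: epowr_def)

lemma epowr_less_top_iff: "0 < a \<Longrightarrow> x epowr a < top \<longleftrightarrow> x < top"
  by (simp add: less_top[symmetric] epowr_eq_top_iff)

lemma epowr_mult:
  assumes "0 < a"
  shows "(x * y) epowr a = x epowr a * y epowr a"
proof (cases "x = 0 \<or> y = 0")
  case True
  then show ?thesis using assms by auto
next
  case False
  show ?thesis
  proof (cases "x = top \<or> y = top")
    case True
    then show ?thesis using assms False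
      by (auto simp: ennreal_top_mult ennreal_mult_top epowr_eq_0_iff)
  next
    case fin: False
    then obtain r s where "x = ennreal r" "0 \<le> r" "y = ennreal s" "0 \<le> s"
      by (metis ennreal_cases)
    then show ?thesis using assms
      by (simp add: ennreal_mult[symmetric] ennreal_epowr powr_mult)
  qed
qed

lemma epowr_epowr:
  assumes "0 < a" "0 < b"
  shows "(x epowr a) epowr b = x epowr (a * b)"
  using assms by (cases x) (simp_all add: ennreal_epowr powr_powr)

lemma epowr_prod:
  assumes "0 < a"
  shows "(\<Prod>i\<in>I. x i) epowr a = (\<Prod>i\<in>I. x i epowr a)"
proof (induction I rule: infinite_finite_induct)
  case (infinite A)
  then show ?case by (simp add: epowr_def)
next
  case empty
  then show ?case by (simp add: epowr_def)
next
  case (insert i I)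
  then show ?case by (simp add: epowr_mult assms)
qed

lemma le_epowr_iff:
  assumes "0 < a"
  shows "x epowr a \<le> y \<longleftrightarrow> x \<le> y epowr (1 / a)"
proof
  assume "x epowr a \<le> y"
  from epowr_mono[OF _ this, of "1/a"] show "x \<le> y epowr (1 / a)"
    using assms by (simp add: epowr_epowr)
next
  assume "x \<le> y epowr (1 / a)"
  from epowr_mono[OF assms this] show "x epowr a \<le> y"
    using assms by (simp add: epowr_epowr)
qed

text \<open>
  The power map is an order isomorphism of \<open>[0,\<infinity>]\<close>, so it commutes with suprema.
\<close>
lemma SUP_epowr_le:
  assumes "0 < a"
  shows "(SUP i\<in>I. x i) epowr a \<le> (SUP i\<in>I. x i epowr a)"
proof -
  have "x i \<le> (SUP i\<in>I. x i epowr a) epowr (1 / a)" if "i \<in> I" for i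
    unfolding le_epowr_iff[OF assms, symmetric] using that by (rule SUP_upper)
  then show ?thesis
    unfolding le_epowr_iff[OF assms] by (rule SUP_least)
qed

lemma borel_measurable_epowr [measurable]:
  assumes [measurable]: "f \<in> borel_measurable M"
  shows "(\<lambda>x. f x epowr a) \<in> borel_measurable M"
  unfolding epowr_def by measurable

text \<open>
  Jensen's inequality for the exponential function, applied to the logarithms of the \<open>x i\<close>.
\<close>
lemma weighted_geometric_le_arithmetic:
  fixes x \<theta> :: "'i \<Rightarrow> real"
  assumes fin: "finite I" and "\<And>i. i \<in> I \<Longrightarrow> 0 < \<theta> i" "sum \<theta> I = 1"
    and nn: "\<And>i. i \<in> I \<Longrightarrow> 0 \<le> x i"
  shows "(\<Prod>i\<in>I. x i powr \<theta> i) \<le> (\<Sum>i\<in>I. \<theta> i * x i)"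
proof (cases "\<exists>i\<in>I. x i = 0")
  case True
  then have "(\<Prod>i\<in>I. x i powr \<theta> i) = 0"
    using fin by (auto intro!: prod_zero)
  also have "0 \<le> (\<Sum>i\<in>I. \<theta> i * x i)"
    using assms by (intro sum_nonneg mult_nonneg_nonneg) (auto simp: less_imp_le)
  finally show ?thesis .
next
  case False
  then have pos: "0 < x i" if "i \<in> I" for i
    using nn that by (auto simp: less_le)
  have ne: "I \<noteq> {}" using assms(3) by auto
  have "exp (\<Sum>i\<in>I. \<theta> i *\<^sub>R ln (x i)) \<le> (\<Sum>i\<in>I. \<theta> i * exp (ln (x i)))"
    by (rule convex_on_sum[OF fin ne exp_convex assms(3)]) (use assms in \<open>auto simp: less_imp_le\<close>)
  also have "\<dots> = (\<Sum>i\<in>I. \<theta> i * x i)"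
    using pos by (intro sum.cong) auto
  also have "exp (\<Sum>i\<in>I. \<theta> i *\<^sub>R ln (x i)) = (\<Prod>i\<in>I. x i powr \<theta> i)"
    unfolding exp_sum[OF fin] using False by (intro prod.cong) (auto simp: powr_def)
  finally show ?thesis .
qed

text \<open>
  Divide each row of the matrix by its sum and apply the weighted inequality between the
  geometric and the arithmetic mean to every column.
\<close>
lemma discrete_Holder_real:
  fixes x :: "'i \<Rightarrow> 'j \<Rightarrow> real"
  assumes fin: "finite I" "finite J" and \<theta>: "\<And>i. i \<in> I \<Longrightarrow> 0 < \<theta> i" "sum \<theta> I = 1"
    and nn: "\<And>i j. i \<in> I \<Longrightarrow> j \<in> J \<Longrightarrow> 0 \<le> x i j"
    and pos: "\<And>i. i \<in> I \<Longrightarrow> 0 < (\<Sum>j\<in>J. x i j)"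
  shows "(\<Sum>j\<in>J. \<Prod>i\<in>I. x i j powr \<theta> i) \<le> (\<Prod>i\<in>I. (\<Sum>j\<in>J. x i j) powr \<theta> i)"
proof -
  define s where "s i = (\<Sum>j\<in>J. x i j)" for i
  have s: "0 < s i" if "i \<in> I" for i using pos[OF that] by (simp add: s_def)
  have "(\<Sum>j\<in>J. \<Prod>i\<in>I. x i j powr \<theta> i)
      = (\<Prod>i\<in>I. s i powr \<theta> i) * (\<Sum>j\<in>J. \<Prod>i\<in>I. (x i j / s i) powr \<theta> i)"
    unfolding sum_distrib_left prod.distrib[symmetric]
    by (intro sum.cong prod.cong refl)
       (use nn s in \<open>simp add: powr_divide less_imp_le less_imp_neq[symmetric]\<close>)
  also have "(\<Sum>j\<in>J. \<Prod>i\<in>I. (x i j / s i) powr \<theta> i) \<le> (\<Sum>j\<in>J. \<Sum>i\<in>I. \<theta> i * (x i j / s i))"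
    by (intro sum_mono weighted_geometric_le_arithmetic fin \<theta>)
       (use nn s in \<open>auto simp: less_imp_le\<close>)
  also have "\<dots> = (\<Sum>i\<in>I. \<theta> i * (s i / s i))"
    by (subst sum.swap) (simp only: sum_distrib_left sum_divide_distrib s_def times_divide_eq_right)
  also have "\<dots> = 1"
    using s \<theta>(2) by (simp add: less_imp_neq[symmetric] cong: sum.cong)
  finally show ?thesis
    by (simp add: mult_left_mono prod_nonneg s_def)
qed

text \<open>
  The conventions for \<open>epowr\<close> make the inequality hold with zero and infinite row sums as well:
  a zero row annihilates both sides, and otherwise an infinite row makes the right-hand side infinite.
\<close>
lemma discrete_Holder:
  fixes x :: "'i \<Rightarrow> 'j \<Rightarrow> ennreal"
  assumes fin: "finite I" "finite J" and \<theta>: "\<And>i. i \<in> I \<Longrightarrow> 0 < \<theta> i" "sum \<theta> I = 1"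
  shows "(\<Sum>j\<in>J. \<Prod>i\<in>I. x i j epowr \<theta> i) \<le> (\<Prod>i\<in>I. (\<Sum>j\<in>J. x i j) epowr \<theta> i)"
proof (cases "\<exists>i\<in>I. (\<Sum>j\<in>J. x i j) = 0")
  case True
  then obtain i where i: "i \<in> I" "\<And>j. j \<in> J \<Longrightarrow> x i j = 0"
    using fin by auto
  have "(\<Prod>i\<in>I. x i j epowr \<theta> i) = 0" if "j \<in> J" for j
    using i fin \<theta>(1) that by (intro prod_zero) (auto intro!: bexI[of _ i])
  then have "(\<Sum>j\<in>J. \<Prod>i\<in>I. x i j epowr \<theta> i) = 0"
    by (intro sum.neutral ballI)
  then show ?thesis by simp
next
  case nonzero: False
  show ?thesis
  proof (cases "\<exists>i\<in>I. (\<Sum>j\<in>J. x i j) = top")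
    case True
    then have "(\<Prod>i\<in>I. (\<Sum>j\<in>J. x i j) epowr \<theta> i) = top"
      using nonzero fin \<theta>(1) by (subst ennreal_prod_eq_top) (auto simp: epowr_eq_top_iff epowr_eq_0_iff)
    then show ?thesis by simp
  next
    case False
    define y where "y i j = enn2real (x i j)" for i j
    have y: "x i j = ennreal (y i j)" if "i \<in> I" "j \<in> J" for i j
      using False that fin unfolding y_def by (auto simp: less_top)
    have ynn: "0 \<le> y i j" for i j by (simp add: y_def)
    have sum_y: "(\<Sum>j\<in>J. x i j) = ennreal (\<Sum>j\<in>J. y i j)" if "i \<in> I" for i
      using that by (simp add: y ynn cong: sum.cong)
    have pos: "0 < (\<Sum>j\<in>J. y i j)" if "i \<in> I" for i
      using nonzero that sum_y[OF that] by (auto simp: less_le sum_nonneg ynn)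
    have "(\<Sum>j\<in>J. \<Prod>i\<in>I. x i j epowr \<theta> i) = ennreal (\<Sum>j\<in>J. \<Prod>i\<in>I. y i j powr \<theta> i)"
      by (simp add: y ynn \<theta>(1) ennreal_epowr prod_ennreal sum_ennreal prod_nonneg cong: sum.cong prod.cong)
    also have "\<dots> \<le> ennreal (\<Prod>i\<in>I. (\<Sum>j\<in>J. y i j) powr \<theta> i)"
      by (intro ennreal_leI discrete_Holder_real fin \<theta> ynn pos)
    also have "\<dots> = (\<Prod>i\<in>I. (\<Sum>j\<in>J. x i j) epowr \<theta> i)"
      by (simp add: sum_y \<theta>(1) ennreal_epowr prod_ennreal sum_nonneg ynn cong: prod.cong)
    finally show ?thesis .
  qed
qed

text \<open>
  This distributes the measure of a set over the factors of a product before Hoelder's inequality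
  is applied.
\<close>
lemma prod_epowr_convex_exponents:
  assumes "\<And>i. i \<in> I \<Longrightarrow> 0 < \<theta> i" "sum \<theta> I = 1" and c: "0 < c" "c < \<infinity>"
  shows "(\<Prod>i\<in>I. c epowr \<theta> i) = c"
proof -
  have fin: "finite I" using assms(2) by (cases "finite I") auto
  obtain r where r: "c = ennreal r" "0 < r"
    using c by (cases c) auto
  have "(\<Prod>i\<in>I. c epowr \<theta> i) = ennreal (\<Prod>i\<in>I. r powr \<theta> i)"
    using r assms(1) by (simp add: ennreal_epowr prod_ennreal cong: prod.cong)
  also have "(\<Prod>i\<in>I. r powr \<theta> i) = r powr sum \<theta> I"
    using r fin by (simp add: powr_sum)
  finally show ?thesis using assms(2) r by simp
qed

section \<open>Cubes and means\<close>

text \<open>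
  The measure of a cube is computed from its side length by \<open>emeasure_cube\<close>, so it is kept in the form
  \<open>emeasure lebesgue\<close>.
\<close>
declare emeasure_completion [simp del]

text \<open>
  A cube is given by its lower corner and its side length. Selections are made among these pairs
  instead of sets, so that the side length is available as a size.
\<close>
type_synonym 'n cube_data = "(real ^ 'n) \<times> real"

definition cube_of :: "'n::finite cube_data \<Rightarrow> (real ^ 'n) set" where
  "cube_of Q = cube (fst Q) (snd Q)"

text \<open>
  The concentric cube of three times the side length.
\<close>
definition triple :: "'n::finite cube_data \<Rightarrow> 'n cube_data" where
  "triple Q = (\<chi> i. fst Q $ i - snd Q, 3 * snd Q)"

definition mean_product :: "nat \<Rightarrow> (nat \<Rightarrow> real ^ 'n \<Rightarrow> ennreal) \<Rightarrow> 'n::finite cube_data \<Rightarrow> ennreal" where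
  "mean_product m g Q = (\<Prod>i = 1..m. mean (g i) (cube_of Q))"

lemma mem_cube: "x \<in> cube a l \<longleftrightarrow> (\<forall>i. a $ i \<le> x $ i \<and> x $ i \<le> a $ i + l)"
  by (auto simp: cube_def mem_box_cart)

lemma cube_of_ne: "0 < snd Q \<Longrightarrow> cube_of Q \<noteq> {}"
  using mem_cube[of "fst Q" "fst Q" "snd Q"] by (auto simp: cube_of_def)

lemma cube_measurable [measurable, simp]: "cube a l \<in> sets lebesgue"
  by (simp add: cube_def)

lemma cube_of_measurable [measurable, simp]: "cube_of Q \<in> sets lebesgue"
  by (simp add: cube_of_def)

lemma emeasure_cube:
  fixes a :: "real ^ 'n"
  assumes "0 < l"
  shows "emeasure lebesgue (cube a l) = ennreal (l ^ CARD('n))"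
proof -
  have "a \<in> cube a l" using assms by (simp add: mem_cube)
  then have "cbox a (\<chi> i. a $ i + l) \<noteq> {}" by (auto simp: cube_def)
  from content_cbox_cart[OF this] show ?thesis
    by (simp add: cube_def emeasure_eq_ennreal_measure emeasure_lborel_cbox_eq emeasure_completion measure_completion)
qed

lemma emeasure_cube_of:
  fixes Q :: "'n::finite cube_data"
  shows "0 < snd Q \<Longrightarrow> emeasure lebesgue (cube_of Q) = ennreal (snd Q ^ CARD('n))"
  unfolding cube_of_def by (rule emeasure_cube)

lemma snd_triple [simp]: "snd (triple Q) = 3 * snd Q"
  by (simp add: triple_def)

lemma emeasure_cube_triple:
  fixes Q :: "'n::finite cube_data"
  shows "0 < snd Q \<Longrightarrow> emeasure lebesgue (cube_of (triple Q)) = 3 ^ CARD('n) * emeasure lebesgue (cube_of Q)"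
  by (simp add: emeasure_cube_of power_mult_distrib ennreal_mult' ennreal_power[symmetric])

text \<open>
  The geometric fact behind every covering argument below: a cube that meets another one of at
  least its size lies in the tripled cube.
\<close>
lemma cube_subset_triple:
  assumes "snd R \<le> snd P" "cube_of R \<inter> cube_of P \<noteq> {}"
  shows "cube_of R \<subseteq> cube_of (triple P)"
proof
  fix x assume x: "x \<in> cube_of R"
  obtain z where z: "z \<in> cube_of R" "z \<in> cube_of P" using assms(2) by auto
  have "fst P $ i - snd P \<le> x $ i \<and> x $ i \<le> (fst P $ i - snd P) + 3 * snd P" for i
    using x[unfolded cube_of_def mem_cube, rule_format, of i] assms(1)
      z[unfolded cube_of_def mem_cube, rule_format, of i] by linarith
  then show "x \<in> cube_of (triple P)"
    by (simp add: cube_of_def triple_def mem_cube)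
qed

lemma cube_containing_two_cubes:
  fixes P Q :: "'n::finite cube_data"
  assumes "0 < snd P" "0 < snd Q"
  obtains R where "0 < snd R" "cube_of P \<subseteq> cube_of R" "cube_of Q \<subseteq> cube_of R"
proof -
  define d where "d = (\<Sum>i\<in>UNIV. \<bar>fst P $ i - fst Q $ i\<bar>)"
  have d: "\<bar>fst P $ i - fst Q $ i\<bar> \<le> d" for i
    unfolding d_def by (rule member_le_sum) auto
  then have "0 \<le> d" by (rule order.trans[OF abs_ge_zero])
  let ?R = "(\<chi> i. min (fst P $ i) (fst Q $ i), d + snd P + snd Q)"
  have "x \<in> cube_of ?R" if x: "x \<in> cube_of P \<union> cube_of Q" for x
  proof -
    have "min (fst P $ i) (fst Q $ i) \<le> x $ i \<and> x $ i \<le> min (fst P $ i) (fst Q $ i) + (d + snd P + snd Q)" for i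
      using x
    proof
      assume "x \<in> cube_of P"
      from this[unfolded cube_of_def mem_cube, rule_format, of i] d[of i] assms show ?thesis
        by linarith
    next
      assume "x \<in> cube_of Q"
      from this[unfolded cube_of_def mem_cube, rule_format, of i] d[of i] assms show ?thesis
        by linarith
    qed
    then show ?thesis by (simp add: cube_of_def mem_cube)
  qed
  with that[of ?R] assms \<open>0 \<le> d\<close> show ?thesis by auto
qed

lemma nn_integral_cube_eq_mean:
  assumes "0 < snd Q"
  shows "(\<integral>\<^sup>+x\<in>cube_of Q. g x \<partial>lebesgue) = emeasure lebesgue (cube_of Q) * mean g (cube_of Q)"
  using assms unfolding mean_def
  by (subst ennreal_times_divide)
     (simp add: emeasure_cube_of ennreal_mult_divide_eq mult.commute[of "ennreal _"])

lemma mean_cong_AE: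
  assumes "AE x in lebesgue. f x = g x"
  shows "mean f Q = mean g Q"
  unfolding mean_def using assms by (intro arg_cong2[of _ _ _ _ "(/)"] nn_integral_cong_AE refl)
    (auto elim!: eventually_mono)

text \<open>
  Integrate over the cubes of side length \<open>2k\<close> centred at the origin, which exhaust the space.
\<close>
lemma AE_zero_if_mean_zero:
  fixes u :: "real ^ 'n \<Rightarrow> ennreal"
  assumes u [measurable]: "u \<in> borel_measurable lebesgue"
    and zero: "\<And>Q :: 'n::finite cube_data. 0 < snd Q \<Longrightarrow> mean u (cube_of Q) = 0"
  shows "AE x in lebesgue. u x = 0"
proof -
  define C where "C k = cube_of ((\<chi> i. - real k) :: real ^ 'n, 2 * real k)" for k
  have "AE x in lebesgue. u x * indicator (C (Suc k)) x = 0" for k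
  proof -
    have "(\<integral>\<^sup>+x\<in>C (Suc k). u x \<partial>lebesgue) = 0"
      unfolding C_def by (subst nn_integral_cube_eq_mean) (auto simp: zero)
    then show ?thesis
      by (subst (asm) nn_integral_0_iff_AE)
        (auto simp: C_def intro!: borel_measurable_times_ennreal borel_measurable_indicator)
  qed
  then have "AE x in lebesgue. \<forall>k. u x * indicator (C (Suc k)) x = 0"
    unfolding AE_all_countable by blast
  then show ?thesis
  proof eventually_elim
    case (elim x)
    obtain k :: nat where "norm x < real k" using reals_Archimedean2 by blast
    then have "- real (Suc k) \<le> x $ i \<and> x $ i \<le> - real (Suc k) + 2 * real (Suc k)" for i
      using component_le_norm_cart[of x i] by (simp add: abs_le_iff)
    then have "x \<in> C (Suc k)"
      unfolding C_def cube_of_def mem_cube by simp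
    then show "u x = 0" using elim[rule_format, of k] by simp
  qed
qed

lemma mean_le_scaled_mean:
  assumes "0 < snd Q" "0 < snd R" "cube_of Q \<subseteq> cube_of R"
    and "emeasure lebesgue (cube_of R) \<le> c * emeasure lebesgue (cube_of Q)"
  shows "mean g (cube_of Q) \<le> c * mean g (cube_of R)"
proof -
  let ?q = "emeasure lebesgue (cube_of Q)" and ?r = "emeasure lebesgue (cube_of R)"
  have "?q * mean g (cube_of Q) \<le> ?r * mean g (cube_of R)"
    unfolding assms(1,2)[THEN nn_integral_cube_eq_mean, symmetric]
    using assms(3) by (intro nn_integral_mono) (auto split: split_indicator)
  also have "\<dots> \<le> (c * ?q) * mean g (cube_of R)"
    by (intro mult_right_mono assms) simp
  finally have "?q * mean g (cube_of Q) \<le> ?q * (c * mean g (cube_of R))"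
    by (simp add: ac_simps)
  then show ?thesis
    using assms(1) by (subst (asm) ennreal_mult_le_mult_iff) (auto simp: emeasure_cube_of)
qed

lemma sum_integral_disjoint_le:
  assumes "finite T" "disjoint_family_on A T" "\<And>R. R \<in> T \<Longrightarrow> A R \<subseteq> B"
    and [measurable]: "g \<in> borel_measurable lebesgue" "\<And>R. R \<in> T \<Longrightarrow> A R \<in> sets lebesgue"
  shows "(\<Sum>R\<in>T. \<integral>\<^sup>+x\<in>A R. g x \<partial>lebesgue) \<le> (\<integral>\<^sup>+x\<in>B. g x \<partial>lebesgue)"
proof -
  have "(\<Sum>R\<in>T. \<integral>\<^sup>+x\<in>A R. g x \<partial>lebesgue) = (\<integral>\<^sup>+x. g x * (\<Sum>R\<in>T. indicator (A R) x) \<partial>lebesgue)"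
    unfolding sum_distrib_left using assms(4,5) by (intro nn_integral_sum[symmetric]) measurable
  also have "\<dots> = (\<integral>\<^sup>+x. g x * indicator (\<Union>R\<in>T. A R) x \<partial>lebesgue)"
    using assms(1,2) by (simp add: indicator_UN_disjoint)
  also have "\<dots> \<le> (\<integral>\<^sup>+x\<in>B. g x \<partial>lebesgue)"
    using assms(3) by (intro nn_integral_mono) (auto split: split_indicator)
  finally show ?thesis .
qed

lemma mean_product_le_scaled:
  assumes "0 < snd Q" "0 < snd R" "cube_of Q \<subseteq> cube_of R"
    and "emeasure lebesgue (cube_of R) \<le> c * emeasure lebesgue (cube_of Q)"
  shows "mean_product m g Q \<le> c ^ m * mean_product m g R"
proof -
  have "mean_product m g Q \<le> (\<Prod>i = 1..m. c * mean (g i) (cube_of R))"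
    unfolding mean_product_def by (intro prod_mono_ennreal mean_le_scaled_mean assms)
  then show ?thesis by (simp add: prod.distrib mean_product_def)
qed

text \<open>
  The \<open>m\<close>-th root turns the product of \<open>m\<close> integrals into a quantity that is homogeneous of degree
  one in the measure of the cube, which is what makes it summable over disjoint cubes.
\<close>
lemma prod_integral_root:
  assumes "1 \<le> m" "0 < snd Q"
  shows "(\<Prod>i = 1..m. (\<integral>\<^sup>+x\<in>cube_of Q. g i x \<partial>lebesgue) epowr (1 / m))
    = emeasure lebesgue (cube_of Q) * mean_product m g Q epowr (1 / m)"
proof -
  let ?q = "emeasure lebesgue (cube_of Q)"
  have "(\<Prod>i = 1..m. (\<integral>\<^sup>+x\<in>cube_of Q. g i x \<partial>lebesgue) epowr (1 / m))
      = (\<Prod>i = 1..m. ?q epowr (1 / m)) * mean_product m g Q epowr (1 / m)"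
    using assms
    by (simp add: nn_integral_cube_eq_mean epowr_mult mean_product_def epowr_prod prod.distrib)
  also have "(\<Prod>i = 1..m. ?q epowr (1 / m)) = (\<Prod>i = 1..m. ?q) epowr (1 / m)"
    using assms by (intro epowr_prod[symmetric]) simp
  also have "\<dots> = ?q"
    using assms
    by (simp add: emeasure_cube_of ennreal_power ennreal_epowr powr_realpow[symmetric] powr_powr)
  finally show ?thesis .
qed

section \<open>Covering and selection of cubes\<close>

text \<open>
  The relation \<open>B P R\<close> is read as ``\<open>P\<close> blocks \<open>R\<close>''. Going through \<open>F\<close> in order of decreasing size
  and keeping an element unless a kept one blocks it produces \<open>S\<close>; as an induction, the smallest
  element is treated last. Symmetry of blocking among elements of equal size excludes that this
  last element blocks a kept one. Blocking by intersection gives the Vitali covering; a finer relation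
  gives the sparse family.
\<close>
lemma greedy_selection:
  fixes B :: "'q \<Rightarrow> 'q \<Rightarrow> bool" and size :: "'q \<Rightarrow> real"
  assumes "finite F" and refl: "\<And>Q. Q \<in> F \<Longrightarrow> B Q Q"
    and ties: "\<And>P R. P \<in> F \<Longrightarrow> R \<in> F \<Longrightarrow> size P = size R \<Longrightarrow> B P R \<Longrightarrow> B R P"
  shows "\<exists>S\<subseteq>F. (\<forall>R\<in>F. \<exists>P\<in>S. size R \<le> size P \<and> B P R) \<and>
      (\<forall>P\<in>S. \<forall>R\<in>S. P \<noteq> R \<longrightarrow> size R \<le> size P \<longrightarrow> \<not> B P R)"
  using assms
proof (induction "card F" arbitrary: F)
  case 0
  have "F = {}" using "0.hyps" "0.prems"(1) by simp
  then show ?case by simp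
next
  case (Suc k)
  have fin: "finite (size ` F)" "size ` F \<noteq> {}" using Suc.hyps(2) Suc.prems(1) by auto
  from Min_in[OF fin] obtain R where R: "R \<in> F" "Min (size ` F) = size R" by (elim imageE)
  have Rmin: "size R \<le> size Q" if "Q \<in> F" for Q
    unfolding R(2)[symmetric] using fin(1) that by (intro Min_le imageI)
  have "k = card (F - {R})" using Suc.hyps(2) Suc.prems(1) R by simp
  have "\<exists>S\<subseteq>F - {R}. (\<forall>Q\<in>F - {R}. \<exists>P\<in>S. size Q \<le> size P \<and> B P Q) \<and>
      (\<forall>P\<in>S. \<forall>Q\<in>S. P \<noteq> Q \<longrightarrow> size Q \<le> size P \<longrightarrow> \<not> B P Q)"
    by (rule Suc.hyps(1)[OF \<open>k = card (F - {R})\<close>])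
      (use Suc.prems(1) in simp, blast intro: Suc.prems(2), blast intro: Suc.prems(3))
  then obtain S where S: "S \<subseteq> F - {R}"
    "\<And>Q. Q \<in> F - {R} \<Longrightarrow> \<exists>P\<in>S. size Q \<le> size P \<and> B P Q"
    "\<And>P Q. P \<in> S \<Longrightarrow> Q \<in> S \<Longrightarrow> P \<noteq> Q \<Longrightarrow> size Q \<le> size P \<Longrightarrow> \<not> B P Q"
    by (elim exE conjE) (metis (no_types))
  show ?case
  proof (cases "\<exists>P\<in>S. B P R")
    case True
    have 2: "\<exists>P\<in>S. size Q \<le> size P \<and> B P Q" if "Q \<in> F" for Q
    proof (cases "Q = R")
      case True
      obtain P where P: "P \<in> S" "B P R" using \<open>\<exists>P\<in>S. B P R\<close> by (elim bexE)
      then have "P \<in> F" using S(1) by auto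
      from P Rmin[OF this] True show ?thesis by auto
    next
      case False
      with that S(2)[of Q] show ?thesis by simp
    qed
    have 3: "S \<subseteq> F" using S(1) by auto
    show ?thesis
      by (rule exI[of _ S], intro conjI ballI impI) (rule 3, erule 2, rule S(3))
  next
    case False
    have "\<not> B R P" if "P \<in> S" "size P \<le> size R" for P
    proof
      assume "B R P"
      moreover have "P \<in> F" using that S(1) by auto
      moreover have "size R = size P" using that(2) Rmin[OF \<open>P \<in> F\<close>] by simp
      ultimately have "B P R" using Suc.prems(3) R(1) by blast
      with that(1) False show False by blast
    qed
    then have 1: "\<not> B P Q"
      if "P \<in> insert R S" "Q \<in> insert R S" "P \<noteq> Q" "size Q \<le> size P" for P Q
      using that False S(3)[of P Q] by (elim insertE) auto
    have 2: "\<exists>P\<in>insert R S. size Q \<le> size P \<and> B P Q" if "Q \<in> F" for Q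
      using that S(2)[of Q] Suc.prems(2)[OF R(1)] by (cases "Q = R") auto
    have 3: "insert R S \<subseteq> F" using S(1) R(1) by auto
    show ?thesis
      by (rule exI[of _ "insert R S"], intro conjI ballI impI) (rule 3, erule 2, rule 1)
  qed
qed

lemma Vitali_cubes:
  fixes T :: "'n::finite cube_data set"
  assumes "finite T" "\<And>R. R \<in> T \<Longrightarrow> 0 < snd R"
  obtains T' where "T' \<subseteq> T" "disjoint_family_on cube_of T'"
    and "emeasure lebesgue (\<Union>R\<in>T. cube_of R) \<le> 3 ^ CARD('n) * (\<Sum>R\<in>T'. emeasure lebesgue (cube_of R))"
proof -
  have "cube_of R \<inter> cube_of R \<noteq> {}" if "R \<in> T" for R
    using assms(2)[OF that] by (simp add: cube_of_ne)
  then obtain T' where T': "T' \<subseteq> T"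
    "\<And>R. R \<in> T \<Longrightarrow> \<exists>P\<in>T'. snd R \<le> snd P \<and> cube_of R \<inter> cube_of P \<noteq> {}"
    "\<And>P R. P \<in> T' \<Longrightarrow> R \<in> T' \<Longrightarrow> P \<noteq> R \<Longrightarrow> snd R \<le> snd P \<Longrightarrow> \<not> cube_of R \<inter> cube_of P \<noteq> {}"
    using greedy_selection[OF assms(1), of "\<lambda>P R. cube_of R \<inter> cube_of P \<noteq> {}" snd] by blast
  have "cube_of P \<inter> cube_of R = {}" if "P \<in> T'" "R \<in> T'" "P \<noteq> R" for P R
    using T'(3)[of P R] T'(3)[of R P] that by (cases "snd R \<le> snd P") auto
  then have disj: "disjoint_family_on cube_of T'"
    unfolding disjoint_family_on_def by blast
  have fin: "finite T'" using T'(1) assms(1) finite_subset by blast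
  have "(\<Union>R\<in>T. cube_of R) \<subseteq> (\<Union>P\<in>T'. cube_of (triple P))"
    using T'(2) cube_subset_triple by blast
  then have "emeasure lebesgue (\<Union>R\<in>T. cube_of R) \<le> emeasure lebesgue (\<Union>P\<in>T'. cube_of (triple P))"
    using fin by (intro emeasure_mono) auto
  also have "\<dots> \<le> (\<Sum>P\<in>T'. emeasure lebesgue (cube_of (triple P)))"
    using fin by (intro emeasure_subadditive_finite) auto
  also have "\<dots> = 3 ^ CARD('n) * (\<Sum>R\<in>T'. emeasure lebesgue (cube_of R))"
    unfolding sum_distrib_left
    by (intro sum.cong refl emeasure_cube_triple) (use T'(1) assms(2) in auto)
  finally show ?thesis using that T'(1) disj by blast
qed

text \<open>
  A multilinear weak-type estimate localised to \<open>3P\<close>, with \<open>\<kappa> = (2 \<cdot> 9\<^sup>n)\<^sup>m\<close> and \<open>A\<close> the product of the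
  means. On disjoint cubes \<open>R\<close> with \<open>A(R) > \<kappa> A(3P)\<close>, the roots of the products of integrals sum, by Hoelder's inequality with exponents \<open>1/m\<close>, to at most
  \<open>|3P| A(3P)\<^bsup>1/m\<^esup>\<close>, so the total measure of these cubes is at most \<open>3\<^sup>n \<kappa>\<^bsup>-1/m\<^esup> |P|\<close>. The Vitali
  covering loses another \<open>3\<^sup>n\<close>, and \<open>\<kappa>\<^bsup>1/m\<^esup> = 2 \<cdot> 9\<^sup>n\<close> leaves one half.
\<close>
lemma subcubes_of_large_mean_are_small:
  fixes P :: "'n::finite cube_data"
  assumes m: "1 \<le> m" and P: "0 < snd P" and fin: "finite T"
    and T: "\<And>R. R \<in> T \<Longrightarrow> 0 < snd R \<and> cube_of R \<subseteq> cube_of (triple P)"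
    and meas: "\<And>i. i \<in> {1..m} \<Longrightarrow> g i \<in> borel_measurable lebesgue"
    and finite_mean: "mean_product m g (triple P) < \<infinity>"
    and large: "\<And>R. R \<in> T \<Longrightarrow>
      ennreal ((2 * 9 ^ CARD('n)) ^ m) * mean_product m g (triple P) < mean_product m g R"
  shows "2 * emeasure lebesgue (\<Union>R\<in>T. cube_of R) \<le> emeasure lebesgue (cube_of P)"
proof (cases "T = {}")
  case False
  let ?n = "CARD('n)" and ?A = "mean_product m g (triple P)" and ?\<mu> = "\<lambda>R. emeasure lebesgue (cube_of R)"
  \<comment> \<open>If \<open>A(3P) = 0\<close> then every subcube has mean product \<open>0\<close>, which contradicts \<open>large\<close>.\<close>
  have "?A \<noteq> 0"
  proof
    assume "?A = 0"
    obtain R where R: "R \<in> T" using False by auto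
    have "mean_product m g R \<le> (?\<mu> (triple P) / ?\<mu> R) ^ m * ?A"
      using T[OF R] P
      by (intro mean_product_le_scaled) (auto simp: emeasure_cube_of divide_ennreal ennreal_mult[symmetric])
    with \<open>?A = 0\<close> large[OF R] show False by simp
  qed
  obtain T' where T': "T' \<subseteq> T" "disjoint_family_on cube_of T'"
    and cover: "emeasure lebesgue (\<Union>R\<in>T. cube_of R) \<le> 3 ^ ?n * (\<Sum>R\<in>T'. ?\<mu> R)"
    using Vitali_cubes[OF fin] T by metis
  have fin': "finite T'" using T'(1) fin finite_subset by blast
  have m': "0 < 1 / real m" using m by simp
  have root: "(b ^ m) powr (1 / m) = b" if "0 < b" for b :: real
    using m that by (simp add: powr_realpow[symmetric] powr_powr)
  have root: "ennreal ((2 * 9 ^ ?n) ^ m) epowr (1 / m) = 2 * 9 ^ ?n"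
  proof -
    have "ennreal ((2 * 9 ^ ?n) ^ m) epowr (1 / m) = ennreal (((2 * 9 ^ ?n) ^ m) powr (1 / m))"
      by (rule ennreal_epowr) (use m in auto)
    also have "\<dots> = ennreal (2 * 9 ^ ?n)"
      by (subst root) auto
    also have "\<dots> = 2 * 9 ^ ?n"
      by (simp add: ennreal_mult ennreal_power[symmetric])
    finally show ?thesis .
  qed
  have "?A epowr (1 / m) * (2 * 9 ^ ?n * (\<Sum>R\<in>T'. ?\<mu> R))
      = (\<Sum>R\<in>T'. ?\<mu> R * (ennreal ((2 * 9 ^ ?n) ^ m) * ?A) epowr (1 / m))"
    unfolding epowr_mult[OF m'] root sum_distrib_left by (simp only: mult_ac)
  also have "\<dots> \<le> (\<Sum>R\<in>T'. ?\<mu> R * mean_product m g R epowr (1 / m))"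
    using m large T'(1) by (intro sum_mono mult_left_mono epowr_mono) (auto intro: less_imp_le)
  also have "\<dots> = (\<Sum>R\<in>T'. \<Prod>i = 1..m. (\<integral>\<^sup>+x\<in>cube_of R. g i x \<partial>lebesgue) epowr (1 / m))"
    using m T T'(1) by (intro sum.cong refl prod_integral_root[symmetric]) auto
  also have "\<dots> \<le> (\<Prod>i = 1..m. (\<Sum>R\<in>T'. \<integral>\<^sup>+x\<in>cube_of R. g i x \<partial>lebesgue) epowr (1 / m))"
    using m fin' by (intro discrete_Holder) auto
  also have "\<dots> \<le> (\<Prod>i = 1..m. (\<integral>\<^sup>+x\<in>cube_of (triple P). g i x \<partial>lebesgue) epowr (1 / m))"
    using m fin' T T' meas by (intro prod_mono_ennreal epowr_mono sum_integral_disjoint_le) auto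
  also have "\<dots> = ?A epowr (1 / m) * (3 ^ ?n * ?\<mu> P)"
    using m P by (subst prod_integral_root) (auto simp: emeasure_cube_triple ac_simps)
  finally have "2 * 9 ^ ?n * (\<Sum>R\<in>T'. ?\<mu> R) \<le> 3 ^ ?n * ?\<mu> P"
    using m \<open>?A \<noteq> 0\<close> finite_mean
    by (subst (asm) ennreal_mult_le_mult_iff) (auto simp: epowr_eq_0_iff epowr_eq_top_iff)
  also have "2 * 9 ^ ?n * (\<Sum>R\<in>T'. ?\<mu> R) = 3 ^ ?n * (2 * (3 ^ ?n * (\<Sum>R\<in>T'. ?\<mu> R)))"
    by (simp add: power_mult_distrib[symmetric] mult.assoc[symmetric] mult.commute[of 2])
  finally have "2 * (3 ^ ?n * (\<Sum>R\<in>T'. ?\<mu> R)) \<le> ?\<mu> P"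
    by (subst (asm) ennreal_mult_le_mult_iff) (auto simp: power_eq_top_ennreal)
  with cover show ?thesis by (meson mult_left_mono order_trans zero_le)
qed simp

text \<open>
  Greedy selection with the rule that \<open>P\<close> blocks \<open>R\<close> if they meet and \<open>A(R) \<le> \<kappa> A(3P)\<close>, where
  \<open>A\<close> is the product of the means and \<open>\<kappa> = (2 \<cdot> 9\<^sup>n)\<^sup>m\<close>. The part \<open>E P\<close> of a selected cube is what
  remains after removing all other selected cubes that are not larger. Two cubes of equal size that meet always block each other, since either one lies in the triple of
  the other and \<open>\<kappa> \<ge> 3\<^bsup>nm\<^esup>\<close>; this is the tie condition of the greedy selection.
\<close>
lemma sparse_selection:
  fixes F :: "'n::finite cube_data set"
  assumes m: "1 \<le> m" and fin: "finite F" and F: "\<And>Q. Q \<in> F \<Longrightarrow> 0 < snd Q"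
    and meas: "\<And>i. i \<in> {1..m} \<Longrightarrow> g i \<in> borel_measurable lebesgue"
    and finite_mean: "\<And>Q. 0 < snd Q \<Longrightarrow> mean_product m g Q < \<infinity>"
  obtains S E where "S \<subseteq> F"
    and "\<And>R. R \<in> F \<Longrightarrow> \<exists>P\<in>S. cube_of R \<subseteq> cube_of (triple P) \<and>
      mean_product m g R \<le> ennreal ((2 * 9 ^ CARD('n)) ^ m) * mean_product m g (triple P)"
    and "\<And>P. P \<in> S \<Longrightarrow> E P \<in> sets lebesgue" "\<And>P. P \<in> S \<Longrightarrow> E P \<subseteq> cube_of P"
    and "disjoint_family_on E S"
    and "\<And>P. P \<in> S \<Longrightarrow> emeasure lebesgue (cube_of P) \<le> 2 * emeasure lebesgue (E P)"
proof -
  let ?n = "CARD('n)"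
  let ?\<kappa> = "ennreal ((2 * 9 ^ ?n) ^ m)"
  define B where "B P R \<longleftrightarrow> cube_of R \<inter> cube_of P \<noteq> {} \<and>
      mean_product m g R \<le> ?\<kappa> * mean_product m g (triple P)" for P R
  have B_ties: "B P R" if "P \<in> F" "R \<in> F" "snd P = snd R" "cube_of R \<inter> cube_of P \<noteq> {}" for P R
  proof -
    have "mean_product m g R \<le> (3 ^ ?n) ^ m * mean_product m g (triple P)"
      using that F[of P] F[of R]
      by (intro mean_product_le_scaled cube_subset_triple) 
        (auto simp: emeasure_cube_of power_mult_distrib ennreal_mult' ennreal_power[symmetric])
    also have "\<dots> \<le> ?\<kappa> * mean_product m g (triple P)"
    proof (intro mult_right_mono)
      have "(3::real) ^ ?n \<le> 9 ^ ?n" by (intro power_mono) auto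
      then have "3 ^ ?n \<le> (2 * 9 ^ ?n :: real)"
        using zero_le_power[of "9::real" ?n] by linarith
      then have "(3 ^ ?n) ^ m \<le> (2 * 9 ^ ?n :: real) ^ m" by (intro power_mono) auto
      from ennreal_leI[OF this] show "(3 ^ ?n) ^ m \<le> ?\<kappa>"
        by (simp add: ennreal_power[symmetric])
    qed simp
    finally show ?thesis using that(4) by (simp add: B_def)
  qed
  have ne: "cube_of Q \<inter> cube_of Q \<noteq> {}" if "Q \<in> F" for Q
    using F[OF that] by (simp add: cube_of_ne)
  have B_refl: "B Q Q" if "Q \<in> F" for Q
    using that ne by (intro B_ties) auto
  have B_sym: "B R P" if "P \<in> F" "R \<in> F" "snd P = snd R" "B P R" for P R
    using that by (intro B_ties) (auto simp: B_def)
  have ex: "\<exists>S\<subseteq>F. (\<forall>R\<in>F. \<exists>P\<in>S. snd R \<le> snd P \<and> B P R) \<and>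
      (\<forall>P\<in>S. \<forall>R\<in>S. P \<noteq> R \<longrightarrow> snd R \<le> snd P \<longrightarrow> \<not> B P R)"
    by (rule greedy_selection[OF fin]) (fact B_refl, fact B_sym)
  obtain S where S: "S \<subseteq> F" "\<And>R. R \<in> F \<Longrightarrow> \<exists>P\<in>S. snd R \<le> snd P \<and> B P R"
    "\<And>P R. P \<in> S \<Longrightarrow> R \<in> S \<Longrightarrow> P \<noteq> R \<Longrightarrow> snd R \<le> snd P \<Longrightarrow> \<not> B P R"
    using ex by (elim exE conjE) (metis (no_types))
  define T where "T P = {R \<in> S. R \<noteq> P \<and> snd R \<le> snd P \<and> cube_of R \<inter> cube_of P \<noteq> {}}" for P
  define E where "E P = cube_of P - (\<Union>R\<in>T P. cube_of R)" for P
  have finS: "finite S" using S(1) fin finite_subset by blast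
  have posS: "0 < snd P" if "P \<in> S" for P using F[of P] S(1) that by blast
  have finT: "finite (T P)" for P using finS by (simp add: T_def)
  have small: "2 * emeasure lebesgue (\<Union>R\<in>T P. cube_of R) \<le> emeasure lebesgue (cube_of P)"
    if P: "P \<in> S" for P
  proof (rule subcubes_of_large_mean_are_small[OF m _ finT])
    show pos: "0 < snd P" using P by (rule posS)
    show "mean_product m g (triple P) < \<infinity>" using finite_mean pos by simp
    fix R assume R: "R \<in> T P"
    then show "0 < snd R \<and> cube_of R \<subseteq> cube_of (triple P)"
      using posS[of R] cube_subset_triple[of R P] unfolding T_def by blast
    show "?\<kappa> * mean_product m g (triple P) < mean_product m g R"
      using S(3)[of P R] R P by (auto simp: T_def B_def)
  qed (use meas in auto)
  show ?thesis
  proof (rule that[OF S(1)])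
    fix R assume "R \<in> F"
    with S(2) obtain P where "P \<in> S" "snd R \<le> snd P" "B P R" by blast
    then show "\<exists>P\<in>S. cube_of R \<subseteq> cube_of (triple P) \<and>
        mean_product m g R \<le> ?\<kappa> * mean_product m g (triple P)"
      by (auto simp: B_def dest: cube_subset_triple intro!: bexI[of _ P])
  next
    fix P assume P: "P \<in> S"
    let ?U = "\<Union>R\<in>T P. cube_of R"
    have U: "?U \<in> sets lebesgue" using finT by (intro sets.finite_UN cube_of_measurable)
    then show EP: "E P \<in> sets lebesgue" unfolding E_def by (intro sets.Diff cube_of_measurable)
    show "E P \<subseteq> cube_of P" by (auto simp: E_def)
    have finP: "emeasure lebesgue (cube_of P) < \<infinity>"
      using posS[OF P] by (simp add: emeasure_cube_of)
    have "emeasure lebesgue (cube_of P) \<le> emeasure lebesgue (E P \<union> ?U)"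
      using U EP by (intro emeasure_mono) (auto simp: E_def)
    also have "\<dots> \<le> emeasure lebesgue (E P) + emeasure lebesgue ?U"
      using U EP by (intro emeasure_subadditive)
    finally have "2 * emeasure lebesgue (cube_of P) \<le> 2 * (emeasure lebesgue (E P) + emeasure lebesgue ?U)"
      by (intro mult_left_mono) auto
    also have "\<dots> \<le> 2 * emeasure lebesgue (E P) + emeasure lebesgue (cube_of P)"
      using small[OF P] by (simp add: distrib_left add_left_mono)
    finally have "emeasure lebesgue (cube_of P) + emeasure lebesgue (cube_of P)
        \<le> emeasure lebesgue (cube_of P) + 2 * emeasure lebesgue (E P)"
      unfolding mult_2[of "emeasure lebesgue (cube_of P)"] by (simp only: add.commute)
    then show "emeasure lebesgue (cube_of P) \<le> 2 * emeasure lebesgue (E P)"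
      using finP by (subst (asm) ennreal_add_left_cancel_le) auto
  next
    have *: "E P \<inter> E R = {}" if "P \<in> S" "R \<in> S" "P \<noteq> R" "snd R \<le> snd P" for P R
      using that unfolding E_def T_def by blast
    show "disjoint_family_on E S"
      unfolding disjoint_family_on_def
    proof (intro ballI impI)
      fix P R assume "P \<in> S" "R \<in> S" "P \<noteq> R"
      then show "E P \<inter> E R = {}"
        using *[of P R] *[of R P] by (cases "snd R \<le> snd P") auto
    qed
  qed
qed

section \<open>Averages in Banach function spaces and their maximal operators\<close>

lemma nn_integral_lebesgue_dilation:
  fixes f :: "real ^ 'n \<Rightarrow> ennreal"
  assumes l: "0 < l" and f: "f \<in> borel_measurable lebesgue"
  shows "(\<integral>\<^sup>+x. f x \<partial>lebesgue) = ennreal (l ^ CARD('n)) * (\<integral>\<^sup>+x. f (l *\<^sub>R x) \<partial>lebesgue)"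
proof -
  have T: "(\<lambda>x. 0 + (\<Sum>j\<in>Basis. (l * (x \<bullet> j)) *\<^sub>R j)) = (\<lambda>x :: real ^ 'n. l *\<^sub>R x)"
    by (simp add: scaleR_scaleR[symmetric] scaleR_sum_right[symmetric] euclidean_representation
        del: scaleR_scaleR)
  have "lebesgue = density (distr lebesgue lebesgue (\<lambda>x :: real ^ 'n. l *\<^sub>R x)) (\<lambda>_. ennreal (l ^ CARD('n)))"
    using lebesgue_affine_euclidean[of "\<lambda>_. l" "0 :: real ^ 'n"] l unfolding T by simp
  then have "(\<integral>\<^sup>+x. f x \<partial>lebesgue)
      = (\<integral>\<^sup>+x. f x \<partial>density (distr lebesgue lebesgue (\<lambda>x :: real ^ 'n. l *\<^sub>R x)) (\<lambda>_. ennreal (l ^ CARD('n))))"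
    by (rule arg_cong)
  also have "\<dots> = ennreal (l ^ CARD('n)) * (\<integral>\<^sup>+x. f (l *\<^sub>R x) \<partial>lebesgue)"
    using f lebesgue_measurable_scaling[of l]
    by (simp add: nn_integral_density nn_integral_distr nn_integral_cmult measurable_compose[of _ lebesgue lebesgue])
  finally show ?thesis .
qed

lemma measurable_cube_dilation:
  assumes "f \<in> borel_measurable lebesgue"
  shows "(\<lambda>x. f (l *\<^sub>R x) * indicator (cube a l) (l *\<^sub>R x) :: ennreal) \<in> borel_measurable lebesgue"
  by (intro measurable_compose[OF lebesgue_measurable_scaling] borel_measurable_times_ennreal
      borel_measurable_indicator cube_measurable assms)

text \<open>
  The reason for the dilation in the definition of \<open>X\<close>-averages: it normalises the cube to measure
  one, so Hoelder's inequality for \<open>X\<close> becomes one for means.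
\<close>
lemma mean_eq_dilated_integral:
  assumes l: "0 < l" and f: "f \<in> borel_measurable lebesgue"
  shows "mean f (cube a l) = (\<integral>\<^sup>+x. f (l *\<^sub>R x) * indicator (cube a l) (l *\<^sub>R x) \<partial>lebesgue)"
proof -
  have "(\<integral>\<^sup>+x\<in>cube a l. f x \<partial>lebesgue)
      = emeasure lebesgue (cube a l) * (\<integral>\<^sup>+x. f (l *\<^sub>R x) * indicator (cube a l) (l *\<^sub>R x) \<partial>lebesgue)"
    unfolding emeasure_cube[OF l]
    by (intro nn_integral_lebesgue_dilation[OF l] borel_measurable_times_ennreal
        borel_measurable_indicator cube_measurable f)
  then show ?thesis
    using l by (simp add: mean_def emeasure_cube mult.commute[of "ennreal _"] ennreal_mult_divide_eq)
qed

lemma mean_pos: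
  assumes l: "0 < l" and f: "f \<in> borel_measurable lebesgue" and pos: "AE x in lebesgue. x \<in> cube a l \<longrightarrow> 0 < f x"
  shows "0 < mean f (cube a l)"
proof (rule ccontr)
  assume "\<not> 0 < mean f (cube a l)"
  then have "(\<integral>\<^sup>+x\<in>cube a l. f x \<partial>lebesgue) = 0"
    using l by (simp add: mean_def ennreal_divide_eq_0_iff emeasure_cube)
  then have "AE x in lebesgue. f x * indicator (cube a l) x = 0"
    using f by (subst (asm) nn_integral_0_iff_AE) auto
  with pos have "AE x in lebesgue. x \<notin> cube a l"
    by eventually_elim (auto split: split_indicator_asm)
  then have "emeasure lebesgue (cube a l) = 0"
    by (subst (asm) AE_iff_measurable[of "cube a l"]) auto
  then show False using l by (simp add: emeasure_cube)
qed

context banach_function_norm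
begin

text \<open>
  A multiple of the indicator of a ball is an admissible test function in the supremum.
\<close>
lemma associate_eq_0_imp_AE_zero:
  assumes [measurable]: "f \<in> borel_measurable lebesgue" and zero: "associate \<rho> f = 0"
  shows "AE x in lebesgue. f x = 0"
proof -
  have "AE x in lebesgue. f x * indicator (ball 0 (real k)) x = 0" for k :: nat
  proof -
    let ?E = "ball (0 :: real ^ 'n) (real k)"
    have E [measurable]: "?E \<in> sets lebesgue" by simp
    note ind = borel_measurable_indicator[OF E, where 'b = ennreal]
    define r where "r = enn2real (\<rho> (indicator ?E))"
    have "\<rho> (indicator ?E) < \<infinity>"
      using emeasure_lborel_ball_finite[of "0 :: real ^ 'n" "real k"]
      by (intro indicator_finite) (auto simp: emeasure_completion)
    then have r: "\<rho> (indicator ?E) = ennreal r" "0 \<le> r" by (auto simp: r_def less_top)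
    \<comment> \<open>The factor \<open>1 / (1 + r)\<close> brings the norm below one, also when \<open>r = 0\<close>.\<close>
    let ?g = "\<lambda>x. ennreal (1 / (1 + r)) * indicator ?E x"
    have "\<rho> ?g = ennreal (1 / (1 + r)) * ennreal r"
      using r by (subst scale[OF ind]) auto
    also have "\<dots> \<le> 1"
      using r(2) by (simp add: ennreal_mult'[symmetric] divide_le_eq_1)
    finally have "(\<integral>\<^sup>+x. f x * ?g x \<partial>lebesgue) \<le> associate \<rho> f"
      unfolding associate_def using ind by (intro SUP_upper) auto
    then have "AE x in lebesgue. f x * ?g x = 0"
      unfolding zero using ind by (subst nn_integral_0_iff_AE[symmetric]) auto
    then show ?thesis
      using r(2) by (auto elim!: eventually_mono simp: add_nonneg_eq_0_iff)
  qed
  then have "AE x in lebesgue. \<forall>k :: nat. f x * indicator (ball 0 (real k)) x = 0"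
    unfolding AE_all_countable by blast
  then show ?thesis
  proof eventually_elim
    case (elim x)
    obtain k :: nat where "norm x < real k" using reals_Archimedean2 by blast
    then show "f x = 0" using elim[rule_format, of k] by simp
  qed
qed

text \<open>
  The inequality holds in \<open>[0,\<infinity>]\<close>, including \<open>0 \<cdot> \<infinity> = 0\<close>, because a vanishing norm of either
  factor makes that factor vanish almost everywhere.
\<close>
lemma Holder_associate:
  assumes [measurable]: "f \<in> borel_measurable lebesgue" "g \<in> borel_measurable lebesgue"
  shows "(\<integral>\<^sup>+x. f x * g x \<partial>lebesgue) \<le> associate \<rho> f * \<rho> g"
proof -
  have null: "(\<integral>\<^sup>+x. f x * g x \<partial>lebesgue) = 0" if "AE x in lebesgue. f x = 0 \<or> g x = 0"
    using that by (subst nn_integral_0_iff_AE) (auto elim!: eventually_mono)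
  consider "\<rho> g = 0" | "associate \<rho> f = 0" | "\<rho> g = \<infinity>" "associate \<rho> f \<noteq> 0" | "\<rho> g \<noteq> 0" "\<rho> g \<noteq> \<infinity>"
    by blast
  then show ?thesis
  proof cases
    case 1
    then have "AE x in lebesgue. g x = 0" by (simp add: zero_iff)
    then show ?thesis by (subst null) (auto elim!: eventually_mono)
  next
    case 2
    then have "AE x in lebesgue. f x = 0" by (intro associate_eq_0_imp_AE_zero) auto
    then show ?thesis by (subst null) (auto elim!: eventually_mono)
  next
    case 3
    then show ?thesis by (simp add: ennreal_mult_top)
  next
    case 4
    define r where "r = enn2real (\<rho> g)"
    have r: "\<rho> g = ennreal r" "0 < r"
      using 4 by (auto simp: r_def less_top enn2real_positive_iff zero_less_iff_neq_zero)
    let ?h = "\<lambda>x. ennreal (1 / r) * g x"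
    have "\<rho> ?h = 1"
      using r by (subst scale) (auto simp: ennreal_mult'[symmetric])
    then have "(\<integral>\<^sup>+x. f x * ?h x \<partial>lebesgue) \<le> associate \<rho> f"
      unfolding associate_def by (intro SUP_upper) auto
    then have "ennreal r * (\<integral>\<^sup>+x. f x * ?h x \<partial>lebesgue) \<le> ennreal r * associate \<rho> f"
      by (rule mult_left_mono) simp
    also have "ennreal r * (\<integral>\<^sup>+x. f x * ?h x \<partial>lebesgue) = (\<integral>\<^sup>+x. f x * g x \<partial>lebesgue)"
      using r(2) by (subst nn_integral_cmult[symmetric])
        (auto intro!: nn_integral_cong simp: mult.assoc[symmetric] mult.left_commute[of "ennreal r"] ennreal_mult'[symmetric]
          mult.commute[of "f _"])
    finally show ?thesis by (simp add: r(1) mult.commute)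
  qed
qed

lemma mean_times_le_cube_averages:
  assumes "0 < l" and [measurable]: "f \<in> borel_measurable lebesgue" "g \<in> borel_measurable lebesgue"
  shows "mean (\<lambda>x. f x * g x) (cube a l) \<le> cube_average (associate \<rho>) a l f * cube_average \<rho> a l g"
proof -
  have "mean (\<lambda>x. f x * g x) (cube a l) = (\<integral>\<^sup>+x. (f (l *\<^sub>R x) * indicator (cube a l) (l *\<^sub>R x)) *
      (g (l *\<^sub>R x) * indicator (cube a l) (l *\<^sub>R x)) \<partial>lebesgue)"
    using assms(1) by (subst mean_eq_dilated_integral) (auto intro!: nn_integral_cong split: split_indicator)
  also have "\<dots> \<le> cube_average (associate \<rho>) a l f * cube_average \<rho> a l g"
    unfolding cube_average_def by (intro Holder_associate measurable_cube_dilation) auto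
  finally show ?thesis .
qed

lemma cube_average_pos:
  assumes "0 < l" "f \<in> borel_measurable lebesgue" "AE x in lebesgue. x \<in> cube a l \<longrightarrow> 0 < f x"
  shows "0 < cube_average \<rho> a l f" "0 < cube_average (associate \<rho>) a l f"
proof -
  have "\<not> (AE x in lebesgue. f (l *\<^sub>R x) * indicator (cube a l) (l *\<^sub>R x) = 0)"
    using mean_pos[OF assms] unfolding mean_eq_dilated_integral[OF assms(1,2)]
    by (subst (asm) zero_less_iff_neq_zero, subst (asm) nn_integral_0_iff_AE)
       (auto intro: measurable_cube_dilation assms(2))
  then show "0 < cube_average \<rho> a l f" "0 < cube_average (associate \<rho>) a l f"
    unfolding cube_average_def zero_less_iff_neq_zero
    using zero_iff[OF measurable_cube_dilation[OF assms(2)]]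
      associate_eq_0_imp_AE_zero[OF measurable_cube_dilation[OF assms(2)]] by blast+
qed

end

text \<open>
  On \<open>E P\<close> the maximal function is at least the average over the cube \<open>T P\<close> that contains \<open>E P\<close>. In
  the application \<open>E P\<close> is a part of \<open>P\<close> and \<open>T P\<close> is the tripled cube.
\<close>
lemma sum_cube_average_le_maximal:
  fixes \<rho> :: "(real ^ 'n \<Rightarrow> ennreal) \<Rightarrow> ennreal"
  assumes "finite S" "disjoint_family_on E S" "\<And>P. P \<in> S \<Longrightarrow> E P \<in> sets lebesgue"
    and "\<And>P. P \<in> S \<Longrightarrow> E P \<subseteq> cube_of (T P)" "\<And>P. P \<in> S \<Longrightarrow> 0 < snd (T P)" and q: "0 < q"
  shows "(\<Sum>P\<in>S. emeasure lebesgue (E P) * cube_average \<rho> (fst (T P)) (snd (T P)) f epowr q)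
    \<le> (\<integral>\<^sup>+x. maximal \<rho> f x epowr q \<partial>lebesgue)"
proof -
  let ?G = "\<lambda>P. cube_average \<rho> (fst (T P)) (snd (T P)) f"
  have "(\<Sum>P\<in>S. emeasure lebesgue (E P) * ?G P epowr q)
      = (\<integral>\<^sup>+x. (\<Sum>P\<in>S. ?G P epowr q * indicator (E P) x) \<partial>lebesgue)"
    using assms(3) by (simp add: nn_integral_sum nn_integral_cmult_indicator) (simp add: mult.commute)
  also have "\<dots> \<le> (\<integral>\<^sup>+x. maximal \<rho> f x epowr q \<partial>lebesgue)"
  proof (rule nn_integral_mono)
    fix x
    show "(\<Sum>P\<in>S. ?G P epowr q * indicator (E P) x) \<le> maximal \<rho> f x epowr q"
    proof (cases "\<exists>P\<in>S. x \<in> E P")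
      case True
      then obtain P where P: "P \<in> S" "x \<in> E P" by blast
      have other: "x \<notin> E R" if "R \<in> S - {P}" for R
        using assms(2) P that unfolding disjoint_family_on_def by blast
      have "(\<Sum>R\<in>S. ?G R epowr q * indicator (E R) x) = ?G P epowr q"
        using P other by (subst sum.remove[OF assms(1) P(1)]) simp
      also have "?G P \<le> maximal \<rho> f x"
        unfolding maximal_def using P assms(4,5)[of P]
        by (intro SUP_upper2[of "T P"]) (auto simp: cube_of_def split: prod.split)
      finally show ?thesis using q by (simp add: epowr_mono)
    qed auto
  qed
  finally show ?thesis .
qed

text \<open>
  The infimum defining the operator norm is attained. Finiteness of the norm of \<open>f\<close> excludes the
  product \<open>0 \<cdot> \<infinity>\<close>.
\<close>
lemma Lnorm_maximal_le:
  assumes f: "f \<in> borel_measurable lebesgue" and N: "maximal_opnorm \<rho> q < \<infinity>"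
    and fin: "Lnorm q (\<lambda>_. 1) (modulus f) < \<infinity>"
  shows "Lnorm q (\<lambda>_. 1) (maximal \<rho> (modulus f)) \<le> maximal_opnorm \<rho> q * Lnorm q (\<lambda>_. 1) (modulus f)"
proof -
  let ?c = "Lnorm q (\<lambda>_. 1) (modulus f)" and ?L = "Lnorm q (\<lambda>_. 1) (maximal \<rho> (modulus f))"
  let ?A = "{N. \<forall>f. f \<in> borel_measurable lebesgue \<longrightarrow>
      Lnorm q (\<lambda>_. 1) (maximal \<rho> (modulus f)) \<le> N * Lnorm q (\<lambda>_. 1) (modulus f)}"
  have ne: "?A \<noteq> {}"
  proof
    assume "?A = {}"
    then show False using N unfolding maximal_opnorm_def by (simp only: Inf_empty) simp
  qed
  have le: "?L \<le> N * ?c" if "N \<in> ?A" for N using that f by blast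
  show ?thesis
  proof (cases "?c = 0")
    case True
    then show ?thesis using ne le by fastforce
  next
    case False
    have "?L / ?c \<le> maximal_opnorm \<rho> q"
      unfolding maximal_opnorm_def
    proof (rule Inf_greatest)
      fix N assume "N \<in> ?A"
      from divide_right_mono_ennreal[OF le[OF this], of ?c] show "?L / ?c \<le> N"
        using False fin by (subst (asm) ennreal_mult_divide_eq) auto
    qed
    then have "?c * (?L / ?c) \<le> ?c * maximal_opnorm \<rho> q" by (rule mult_left_mono) simp
    moreover have "?c * (?L / ?c) = ?L"
      using False fin by (subst ennreal_times_divide, subst mult.commute, subst ennreal_mult_divide_eq) auto
    ultimately show ?thesis by (simp add: mult.commute)
  qed
qed

text \<open>
  Test the operator on the indicator of the unit cube: the average of this indicator over the cube
  with respect to the associate norm is positive. Positivity is what makes the right-hand side of the main estimate infinite when some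
  \<open>f i\<close> has infinite norm.
\<close>
lemma (in banach_function_norm) maximal_opnorm_associate_pos:
  assumes q: "0 < q"
  shows "0 < maximal_opnorm (associate \<rho>) q"
proof (rule ccontr)
  assume "\<not> 0 < maximal_opnorm (associate \<rho>) q"
  then have zero: "maximal_opnorm (associate \<rho>) q = 0" by simp
  let ?Q = "cube (0 :: real ^ 'n) 1"
  define f :: "real ^ 'n \<Rightarrow> real" where "f = indicator ?Q"
  have f [measurable]: "f \<in> borel_measurable lebesgue" by (simp add: f_def)
  have "modulus f x epowr q = indicator ?Q x" for x
    using q by (auto simp: f_def epowr_def split: split_indicator)
  then have "Lnorm q (\<lambda>_. 1) (modulus f) = 1"
    by (simp add: Lnorm_def emeasure_cube epowr_def)
  then have "Lnorm q (\<lambda>_. 1) (maximal (associate \<rho>) (modulus f)) = 0"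
    using Lnorm_maximal_le[OF f, of "associate \<rho>" q] zero by simp
  then have "(\<integral>\<^sup>+x. maximal (associate \<rho>) (modulus f) x epowr q \<partial>lebesgue) = 0"
    using q by (simp add: Lnorm_def epowr_eq_0_iff)
  moreover have "0 < cube_average (associate \<rho>) 0 1 (modulus f)"
    by (intro cube_average_pos) (auto simp: f_def)
  ultimately show False
    using sum_cube_average_le_maximal[of "{(0, 1)}" "\<lambda>_. ?Q" "\<lambda>Q. Q" q "associate \<rho>" "modulus f"] q
    by (auto simp: cube_of_def disjoint_family_on_def emeasure_cube epowr_eq_0_iff)
qed

section \<open>The weighted estimate for finite families of cubes\<close>

text \<open>
  The step in which \<open>u\<close> and the averages of the \<open>v\<^sub>i\<close> disappear into the weight constant.
\<close>
lemma averages_weight_bound: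
  assumes p: "0 < p"
    and mean: "\<And>i. i \<in> {1..m} \<Longrightarrow> mean (g i) (cube_of Q) \<le> G i * W i"
    and K: "mean u (cube_of Q) epowr (1 / p) * (\<Prod>i = 1..m. W i) \<le> K"
  shows "mean_product m g Q epowr p * mean u (cube_of Q) \<le> K epowr p * (\<Prod>i = 1..m. G i epowr p)"
proof -
  have "mean_product m g Q epowr p * mean u (cube_of Q)
      = (mean_product m g Q * mean u (cube_of Q) epowr (1 / p)) epowr p"
    using p by (simp add: epowr_mult epowr_epowr)
  also have "\<dots> \<le> ((\<Prod>i = 1..m. G i * W i) * mean u (cube_of Q) epowr (1 / p)) epowr p"
    unfolding mean_product_def
    using p mean by (intro epowr_mono mult_right_mono prod_mono_ennreal) auto
  also have "\<dots> = ((mean u (cube_of Q) epowr (1 / p) * (\<Prod>i = 1..m. W i)) * (\<Prod>i = 1..m. G i)) epowr p"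
    by (simp add: prod.distrib mult_ac)
  also have "\<dots> \<le> (K * (\<Prod>i = 1..m. G i)) epowr p"
    using p K by (intro epowr_mono mult_right_mono) auto
  also have "\<dots> = K epowr p * (\<Prod>i = 1..m. G i epowr p)"
    using p by (simp add: epowr_mult epowr_prod)
  finally show ?thesis .
qed

text \<open>
  The core estimate, for the maximal function of a finite family \<open>F\<close>. Stated for abstract \<open>G\<close> and \<open>W\<close>:
  all that matters of the Banach function spaces is the Hoelder bound \<open>mean_le\<close>, the weight
  condition \<open>K\<close> and the \<open>packing\<close> bound on disjoint pieces.
\<close>
lemma finite_family_maximal_bound:
  fixes F :: "'n::finite cube_data set"
  assumes m: "1 \<le> m" and fin: "finite F" and F: "\<And>Q. Q \<in> F \<Longrightarrow> 0 < snd Q"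
    and p: "0 < p" and ps: "\<And>i. i \<in> {1..m} \<Longrightarrow> 0 < ps i" and sum_ps: "1 / p = (\<Sum>i = 1..m. 1 / ps i)"
    and u: "u \<in> borel_measurable lebesgue"
    and g: "\<And>i. i \<in> {1..m} \<Longrightarrow> g i \<in> borel_measurable lebesgue"
    and finite_mean: "\<And>Q. 0 < snd Q \<Longrightarrow> mean_product m g Q < \<infinity>"
    and mean_le: "\<And>i Q. i \<in> {1..m} \<Longrightarrow> 0 < snd Q \<Longrightarrow> mean (g i) (cube_of Q) \<le> G i Q * W i Q"
    and K: "\<And>Q. 0 < snd Q \<Longrightarrow> mean u (cube_of Q) epowr (1 / p) * (\<Prod>i = 1..m. W i Q) \<le> K"
    and packing: "\<And>i S E. i \<in> {1..m} \<Longrightarrow> finite S \<Longrightarrow> disjoint_family_on E S \<Longrightarrow>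
      (\<And>P. P \<in> S \<Longrightarrow> 0 < snd P \<and> E P \<in> sets lebesgue \<and> E P \<subseteq> cube_of (triple P)) \<Longrightarrow>
      (\<Sum>P\<in>S. emeasure lebesgue (E P) * G i (triple P) epowr ps i) \<le> M i"
  shows "(\<integral>\<^sup>+x. (SUP Q\<in>F. mean_product m g Q epowr p * indicator (cube_of Q) x) * u x \<partial>lebesgue)
    \<le> ennreal ((2 * 9 ^ CARD('n)) ^ m) epowr p * (2 * 3 ^ CARD('n)) * K epowr p *
      (\<Prod>i = 1..m. M i epowr (p / ps i))"
proof -
  let ?\<kappa> = "ennreal ((2 * 9 ^ CARD('n)) ^ m)" and ?\<mu> = "\<lambda>A. emeasure lebesgue A"
  let ?A = "mean_product m g"
  obtain S E where S: "S \<subseteq> F"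
    and dom: "\<And>R. R \<in> F \<Longrightarrow> \<exists>P\<in>S. cube_of R \<subseteq> cube_of (triple P) \<and> ?A R \<le> ?\<kappa> * ?A (triple P)"
    and E: "\<And>P. P \<in> S \<Longrightarrow> E P \<in> sets lebesgue" "\<And>P. P \<in> S \<Longrightarrow> E P \<subseteq> cube_of P"
    and disj: "disjoint_family_on E S"
    and large: "\<And>P. P \<in> S \<Longrightarrow> ?\<mu> (cube_of P) \<le> 2 * ?\<mu> (E P)"
    using sparse_selection[OF m fin F g finite_mean] by blast
  have posS: "0 < snd P" if "P \<in> S" for P using F[of P] S that by blast
  have finS: "finite S" using S fin finite_subset by blast
  have \<theta>: "0 < p / ps i" if "i \<in> {1..m}" for i using p ps[OF that] by simp
  have sum_\<theta>: "(\<Sum>i = 1..m. p / ps i) = 1"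
  proof -
    have "(\<Sum>i = 1..m. p / ps i) = p * (\<Sum>i = 1..m. 1 / ps i)" by (simp add: sum_distrib_left)
    then show ?thesis unfolding sum_ps[symmetric] using p by simp
  qed
  have triple_sub: "cube_of P \<subseteq> cube_of (triple P)" if "P \<in> S" for P
    using cube_subset_triple[of P P] cube_of_ne[OF posS[OF that]] by simp
  have pointwise: "(SUP Q\<in>F. ?A Q epowr p * indicator (cube_of Q) x) * u x
      \<le> (\<Sum>P\<in>S. ?\<kappa> epowr p * ?A (triple P) epowr p * (u x * indicator (cube_of (triple P)) x))" for x
  proof -
    have "(SUP Q\<in>F. ?A Q epowr p * indicator (cube_of Q) x)
        \<le> (\<Sum>P\<in>S. ?\<kappa> epowr p * ?A (triple P) epowr p * indicator (cube_of (triple P)) x)"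
    proof (rule SUP_least)
      fix R assume "R \<in> F"
      from dom[OF this] obtain P where P: "P \<in> S" "cube_of R \<subseteq> cube_of (triple P)"
        "?A R \<le> ?\<kappa> * ?A (triple P)" by blast
      have "?A R epowr p * indicator (cube_of R) x
          \<le> (?\<kappa> * ?A (triple P)) epowr p * indicator (cube_of (triple P)) x"
        using P p by (intro mult_mono epowr_mono) (auto split: split_indicator)
      also have "\<dots> = ?\<kappa> epowr p * ?A (triple P) epowr p * indicator (cube_of (triple P)) x"
        by (simp only: epowr_mult[OF p])
      also have "\<dots> \<le> (\<Sum>P\<in>S. ?\<kappa> epowr p * ?A (triple P) epowr p * indicator (cube_of (triple P)) x)"
        by (rule member_le_sum[OF P(1) _ finS]) auto
      finally show "?A R epowr p * indicator (cube_of R) x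
        \<le> (\<Sum>P\<in>S. ?\<kappa> epowr p * ?A (triple P) epowr p * indicator (cube_of (triple P)) x)" .
    qed
    from mult_right_mono[OF this zero_le[of "u x"]] show ?thesis
      unfolding sum_distrib_right by (simp only: mult_ac)
  qed
  have "(\<integral>\<^sup>+x. (SUP Q\<in>F. ?A Q epowr p * indicator (cube_of Q) x) * u x \<partial>lebesgue)
      \<le> (\<integral>\<^sup>+x. (\<Sum>P\<in>S. ?\<kappa> epowr p * ?A (triple P) epowr p * (u x * indicator (cube_of (triple P)) x)) \<partial>lebesgue)"
    by (intro nn_integral_mono pointwise)
  also have "\<dots> = (\<Sum>P\<in>S. ?\<kappa> epowr p * ?A (triple P) epowr p * (\<integral>\<^sup>+x\<in>cube_of (triple P). u x \<partial>lebesgue))"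
    using u by (simp add: nn_integral_sum nn_integral_cmult)
  also have "\<dots> = (\<Sum>P\<in>S. ?\<kappa> epowr p * ?\<mu> (cube_of (triple P)) *
      (?A (triple P) epowr p * mean u (cube_of (triple P))))"
    using posS by (intro sum.cong refl) (simp add: nn_integral_cube_eq_mean mult_ac)
  also have "\<dots> \<le> (\<Sum>P\<in>S. ?\<kappa> epowr p * (2 * 3 ^ CARD('n) * ?\<mu> (E P)) *
      (K epowr p * (\<Prod>i = 1..m. G i (triple P) epowr p)))"
  proof (rule sum_mono)
    fix P assume P: "P \<in> S"
    have pos: "0 < snd (triple P)" using posS[OF P] by simp
    have "?\<mu> (cube_of (triple P)) = 3 ^ CARD('n) * ?\<mu> (cube_of P)"
      using posS[OF P] by (rule emeasure_cube_triple)
    also have "\<dots> \<le> 3 ^ CARD('n) * (2 * ?\<mu> (E P))"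
      by (intro mult_left_mono large P) simp
    finally have volume: "?\<mu> (cube_of (triple P)) \<le> 2 * 3 ^ CARD('n) * ?\<mu> (E P)"
      by (simp only: mult_ac)
    have weight: "?A (triple P) epowr p * mean u (cube_of (triple P))
        \<le> K epowr p * (\<Prod>i = 1..m. G i (triple P) epowr p)"
      by (rule averages_weight_bound[OF p mean_le[OF _ pos] K[OF pos]])
    show "?\<kappa> epowr p * ?\<mu> (cube_of (triple P)) * (?A (triple P) epowr p * mean u (cube_of (triple P)))
        \<le> ?\<kappa> epowr p * (2 * 3 ^ CARD('n) * ?\<mu> (E P)) * (K epowr p * (\<Prod>i = 1..m. G i (triple P) epowr p))"
      by (rule mult_mono[OF mult_left_mono[OF volume] weight]) auto
  qed
  also have "\<dots> = ?\<kappa> epowr p * (2 * 3 ^ CARD('n)) * K epowr p *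
      (\<Sum>P\<in>S. ?\<mu> (E P) * (\<Prod>i = 1..m. G i (triple P) epowr p))"
    unfolding sum_distrib_left by (simp only: mult_ac)
  \<comment> \<open>The exponents \<open>p / ps i\<close> add up to one, so \<open>|E P|\<close> splits into its powers.\<close>
  also have "(\<Sum>P\<in>S. ?\<mu> (E P) * (\<Prod>i = 1..m. G i (triple P) epowr p))
      = (\<Sum>P\<in>S. \<Prod>i = 1..m. (?\<mu> (E P) * G i (triple P) epowr ps i) epowr (p / ps i))"
  proof (intro sum.cong refl)
    fix P assume P: "P \<in> S"
    have "0 < ?\<mu> (cube_of P)" using posS[OF P] by (simp add: emeasure_cube_of)
    with large[OF P] have "0 < ?\<mu> (E P)" by (auto simp: zero_less_iff_neq_zero)
    moreover have "?\<mu> (E P) < \<infinity>"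
      using emeasure_mono[OF E(2)[OF P], of lebesgue] posS[OF P]
      by (auto simp: emeasure_cube_of intro: le_less_trans)
    ultimately have "(\<Prod>i = 1..m. ?\<mu> (E P) epowr (p / ps i)) = ?\<mu> (E P)"
      by (intro prod_epowr_convex_exponents \<theta> sum_\<theta>)
    moreover have "(\<Prod>i = 1..m. (?\<mu> (E P) * G i (triple P) epowr ps i) epowr (p / ps i))
        = (\<Prod>i = 1..m. ?\<mu> (E P) epowr (p / ps i) * G i (triple P) epowr p)"
    proof (intro prod.cong refl)
      fix i assume i: "i \<in> {1..m}"
      have "ps i * (p / ps i) = p" using ps[OF i] by simp
      then show "(?\<mu> (E P) * G i (triple P) epowr ps i) epowr (p / ps i)
          = ?\<mu> (E P) epowr (p / ps i) * G i (triple P) epowr p"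
        using epowr_epowr[OF ps[OF i] \<theta>[OF i]] by (simp add: epowr_mult[OF \<theta>[OF i]])
    qed
    ultimately show "?\<mu> (E P) * (\<Prod>i = 1..m. G i (triple P) epowr p)
        = (\<Prod>i = 1..m. (?\<mu> (E P) * G i (triple P) epowr ps i) epowr (p / ps i))"
      by (simp add: prod.distrib)
  qed
  also have "\<dots> \<le> (\<Prod>i = 1..m. (\<Sum>P\<in>S. ?\<mu> (E P) * G i (triple P) epowr ps i) epowr (p / ps i))"
    using finS \<theta> sum_\<theta> by (intro discrete_Holder) auto
  also have "\<dots> \<le> (\<Prod>i = 1..m. M i epowr (p / ps i))"
  proof (intro prod_mono_ennreal epowr_mono \<theta> packing finS disj)
    fix P assume "P \<in> S"
    then show "0 < snd P \<and> E P \<in> sets lebesgue \<and> E P \<subseteq> cube_of (triple P)"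
      using posS E triple_sub by blast
  qed auto
  finally show ?thesis by (simp add: mult_left_mono)
qed

section \<open>From finite families to all cubes\<close>

definition rational_cubes :: "'n::finite cube_data set" where
  "rational_cubes = {a. \<forall>i. a $ i \<in> \<rat>} \<times> (\<rat> \<inter> {0<..})"

lemma countable_rational_cubes: "countable rational_cubes"
  unfolding rational_cubes_def
  by (intro countable_SIGMA countable_vector countable_Int1 countable_rat)

text \<open>
  With side length between \<open>3/2\<close> and \<open>2\<close> times that of \<open>Q\<close>, the corner can still be moved by half the
  side length of \<open>Q\<close>.
\<close>
lemma rational_cube_covering:
  fixes Q :: "'n::finite cube_data"
  assumes Q: "0 < snd Q"
  obtains R where "R \<in> rational_cubes" "0 < snd R" "cube_of Q \<subseteq> cube_of R" "snd R \<le> 2 * snd Q"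
proof -
  obtain l where l: "l \<in> \<rat>" "3/2 * snd Q < l" "l < 2 * snd Q"
    using Rats_dense_in_real[of "3/2 * snd Q" "2 * snd Q"] Q by auto
  have "\<exists>r\<in>\<rat>. fst Q $ i - snd Q / 2 < r \<and> r < fst Q $ i" for i
    using Rats_dense_in_real[of "fst Q $ i - snd Q / 2" "fst Q $ i"] Q by auto
  then obtain b where b: "\<And>i. b i \<in> \<rat>" "\<And>i. fst Q $ i - snd Q / 2 < b i" "\<And>i. b i < fst Q $ i"
    by metis
  let ?R = "(\<chi> i. b i, l)"
  have "x \<in> cube_of ?R" if "x \<in> cube_of Q" for x
  proof -
    have "b i \<le> x $ i \<and> x $ i \<le> b i + l" for i
      using that[unfolded cube_of_def mem_cube, rule_format, of i] b(2,3)[of i] l(2) by linarith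
    then show ?thesis by (simp add: cube_of_def mem_cube)
  qed
  then show ?thesis
    using that[of ?R] l b(1) Q by (auto simp: rational_cubes_def)
qed

text \<open>
  The factor \<open>2\<^sup>n\<close> for each of the \<open>m\<close> means bounds the ratio of the measures of the enlarged and the
  given cube.
\<close>
lemma multi_maximal_epowr_le:
  fixes f :: "nat \<Rightarrow> real ^ 'n \<Rightarrow> real"
  assumes p: "0 < p"
  shows "multi_maximal m f x epowr p \<le> ennreal ((2 ^ CARD('n)) ^ m) epowr p *
    (SUP R\<in>rational_cubes. mean_product m (\<lambda>i. modulus (f i)) R epowr p * indicator (cube_of R) x)"
proof -
  let ?A = "mean_product m (\<lambda>i. modulus (f i))" and ?c = "ennreal ((2 ^ CARD('n)) ^ m)"
  let ?D = "{(a, l). 0 < l \<and> x \<in> cube a l}"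
  have eq: "multi_maximal m f x = (SUP Q\<in>?D. ?A Q)"
    unfolding multi_maximal_def mean_product_def cube_of_def by (intro SUP_cong) auto
  have "multi_maximal m f x epowr p \<le> (SUP Q\<in>?D. ?A Q epowr p)"
    unfolding eq by (rule SUP_epowr_le[OF p])
  also have "\<dots> \<le> ?c epowr p * (SUP R\<in>rational_cubes. ?A R epowr p * indicator (cube_of R) x)"
  proof (rule SUP_least)
    fix Q assume Q: "Q \<in> ?D"
    then have pos: "0 < snd Q" and x: "x \<in> cube_of Q" by (auto simp: cube_of_def)
    obtain R where R: "R \<in> rational_cubes" "0 < snd R" "cube_of Q \<subseteq> cube_of R" "snd R \<le> 2 * snd Q"
      by (rule rational_cube_covering[OF pos])
    have "snd R ^ CARD('n) \<le> 2 ^ CARD('n) * snd Q ^ CARD('n)"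
      unfolding power_mult_distrib[symmetric] using R by (intro power_mono) auto
    then have "emeasure lebesgue (cube_of R) \<le> ennreal (2 ^ CARD('n)) * emeasure lebesgue (cube_of Q)"
      using R pos by (simp only: emeasure_cube_of) (simp add: ennreal_mult[symmetric] del: ennreal_numeral)
    from mean_product_le_scaled[OF pos R(2,3) this]
    have "?A Q \<le> ?c * ?A R" by (simp add: ennreal_power)
    then have "?A Q epowr p \<le> ?c epowr p * (?A R epowr p * indicator (cube_of R) x)"
      using epowr_mono[OF p] x R(3) by (auto simp: epowr_mult[OF p, symmetric])
    also have "\<dots> \<le> ?c epowr p * (SUP R\<in>rational_cubes. ?A R epowr p * indicator (cube_of R) x)"
      using R(1) by (intro mult_left_mono SUP_upper) auto
    finally show "?A Q epowr p \<le> ?c epowr p * (SUP R\<in>rational_cubes. ?A R epowr p * indicator (cube_of R) x)" .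
  qed
  finally show ?thesis .
qed

text \<open>
  Monotone convergence along finite initial segments of an enumeration of \<open>D\<close>.
\<close>
lemma nn_integral_countable_SUP_le:
  assumes D: "countable D" and [measurable]: "\<And>Q. Q \<in> D \<Longrightarrow> h Q \<in> borel_measurable M" "u \<in> borel_measurable M"
    and bound: "\<And>F. finite F \<Longrightarrow> F \<subseteq> D \<Longrightarrow> (\<integral>\<^sup>+x. (SUP Q\<in>F. h Q x) * u x \<partial>M) \<le> (B :: ennreal)"
  shows "(\<integral>\<^sup>+x. (SUP Q\<in>D. h Q x) * u x \<partial>M) \<le> B"
proof (cases "D = {}")
  case True
  then show ?thesis by (simp add: bot_ennreal)
next
  case False
  define F where "F k = from_nat_into D ` {..k}" for k
  have F: "finite (F k)" "F k \<subseteq> D" for k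
    using from_nat_into[OF False] by (auto simp: F_def)
  have UF: "(\<Union>k. F k) = D"
  proof -
    have "(\<Union>k. F k) = from_nat_into D ` (\<Union>k. {..k})" unfolding F_def image_UN ..
    also have "(\<Union>k. {..k}) = (UNIV :: nat set)" by auto
    finally show ?thesis using range_from_nat_into[OF False D] by simp
  qed
  have "(SUP Q\<in>D. h Q x) * u x = (SUP k. (SUP Q\<in>F k. h Q x) * u x)" for x
    unfolding UF[symmetric] by (simp add: SUP_UNION SUP_mult_right_ennreal)
  then have "(\<integral>\<^sup>+x. (SUP Q\<in>D. h Q x) * u x \<partial>M) = (\<integral>\<^sup>+x. (SUP k. (SUP Q\<in>F k. h Q x) * u x) \<partial>M)"
    by simp
  also have "\<dots> = (SUP k. \<integral>\<^sup>+x. (SUP Q\<in>F k. h Q x) * u x \<partial>M)"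
  proof (rule nn_integral_monotone_convergence_SUP)
    show "incseq (\<lambda>k x. (SUP Q\<in>F k. h Q x) * u x)"
      by (auto intro!: incseq_SucI le_funI mult_right_mono SUP_subset_mono simp: F_def)
    show "(\<lambda>x. (SUP Q\<in>F k. h Q x) * u x) \<in> borel_measurable M" for k
      using F[of k] by (intro borel_measurable_times_ennreal borel_measurable_SUP countable_finite assms) auto
  qed
  also have "\<dots> \<le> B" by (intro SUP_least bound F)
  finally show ?thesis .
qed

section \<open>Weighted norms and the weight constant\<close>

lemma Lnorm_eq_0_imp_AE_zero:
  assumes q: "0 < q" and f: "f \<in> borel_measurable lebesgue" and w: "w \<in> borel_measurable lebesgue"
    and pos: "AE x in lebesgue. 0 < w x" and zero: "Lnorm q w f = 0"
  shows "AE x in lebesgue. f x = 0"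
proof -
  have "(\<integral>\<^sup>+x. f x epowr q * w x \<partial>lebesgue) = 0"
    using zero q by (simp add: Lnorm_def epowr_eq_0_iff)
  then have "AE x in lebesgue. f x epowr q * w x = 0"
    using f w by (subst (asm) nn_integral_0_iff_AE) auto
  with pos show ?thesis
    by eventually_elim (use q in \<open>auto simp: epowr_eq_0_iff\<close>)
qed

lemma Lnorm_zero_weight:
  fixes w :: "real ^ 'n \<Rightarrow> ennreal"
  assumes "0 < q" "AE x in lebesgue. w x = 0"
  shows "Lnorm q w h = 0"
proof -
  have "(\<integral>\<^sup>+x. h x epowr q * w x \<partial>lebesgue) = (\<integral>\<^sup>+x. 0 \<partial>(lebesgue :: (real ^ 'n) measure))"
    using assms(2) by (intro nn_integral_cong_AE) (auto elim!: eventually_mono)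
  then show ?thesis using assms(1) by (simp add: Lnorm_def)
qed

lemma multi_maximal_eq_0:
  fixes f :: "nat \<Rightarrow> real ^ 'n \<Rightarrow> real"
  assumes i: "i \<in> {1..m}" and f: "AE x in lebesgue. f i x = 0"
  shows "multi_maximal m f x = 0"
proof -
  have "mean (modulus (f i)) Q = 0" for Q
  proof -
    have "(\<integral>\<^sup>+x\<in>Q. modulus (f i) x \<partial>lebesgue) = (\<integral>\<^sup>+x. 0 \<partial>(lebesgue :: (real ^ 'n) measure))"
      using f by (intro nn_integral_cong_AE) (auto elim!: eventually_mono)
    then show ?thesis by (simp add: mean_def)
  qed
  then have zero: "(\<Prod>i = 1..m. mean (modulus (f i)) Q) = 0" for Q
    using i by (intro prod_zero bexI[of _ i]) auto
  have "multi_maximal m f x \<le> 0"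
    unfolding multi_maximal_def by (rule SUP_least) (simp only: zero split_beta)
  then show ?thesis by simp
qed

text \<open>
  The function \<open>h\<close> moves the weight \<open>v\<close> into the integrand. It has to be real-valued, as the operator
  norm of the maximal operator is defined by real-valued functions; on the null set where \<open>v\<close> is
  infinite, \<open>enn2real\<close> makes it zero.
\<close>
lemma Lnorm_weight_transfer:
  fixes f :: "real ^ 'n \<Rightarrow> real"
  assumes q: "0 < q" and v: "AE x in lebesgue. 0 < v x \<and> v x < \<infinity>"
  defines "h \<equiv> \<lambda>x. \<bar>f x\<bar> * enn2real (v x) powr (1 / q)"
  shows "Lnorm q (\<lambda>_. 1) (modulus h) = Lnorm q v (modulus f)"
    and "AE x in lebesgue. modulus f x = modulus h x * v x epowr (- 1 / q)"
proof -
  have *: "modulus h x epowr q * 1 = modulus f x epowr q * v x \<and>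
      modulus f x = modulus h x * v x epowr (- 1 / q)" if v: "0 < v x \<and> v x < \<infinity>" for x
  proof -
    obtain r where r: "v x = ennreal r" "0 < r" using v by (cases "v x") auto
    have "modulus h x epowr q = ennreal ((\<bar>f x\<bar> * r powr (1 / q)) powr q)"
      using r q by (subst ennreal_epowr) (auto simp: h_def abs_mult)
    also have "(\<bar>f x\<bar> * r powr (1 / q)) powr q = \<bar>f x\<bar> powr q * r"
      using r q by (simp add: powr_mult powr_powr)
    also have "ennreal (\<bar>f x\<bar> powr q * r) = modulus f x epowr q * v x"
      using r q by (simp add: ennreal_epowr ennreal_mult)
    finally have "modulus h x epowr q = modulus f x epowr q * v x" .
    moreover have "\<bar>h x\<bar> * r powr (- 1 / q) = \<bar>f x\<bar>"
      using r q by (simp add: h_def powr_minus field_simps powr_add[symmetric])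
    moreover have "v x epowr (- 1 / q) = ennreal (r powr (- 1 / q))"
      using r q by (simp add: epowr_def)
    ultimately show ?thesis by (simp add: ennreal_mult[symmetric])
  qed
  have "(\<integral>\<^sup>+x. modulus h x epowr q * 1 \<partial>lebesgue) = (\<integral>\<^sup>+x. modulus f x epowr q * v x \<partial>lebesgue)"
    by (rule nn_integral_cong_AE, use v in eventually_elim) (use * in blast)
  then show "Lnorm q (\<lambda>_. 1) (modulus h) = Lnorm q v (modulus f)" by (simp add: Lnorm_def)
  show "AE x in lebesgue. modulus f x = modulus h x * v x epowr (- 1 / q)"
    using v by eventually_elim (use * in blast)
qed

lemma cube_average_weight_pos:
  assumes X: "banach_function_norm \<rho>" and Q: "0 < snd Q" and w: "w \<in> borel_measurable lebesgue"
    and pos: "AE x in lebesgue. 0 < w x \<and> w x < \<infinity>"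
  shows "0 < cube_average \<rho> (fst Q) (snd Q) (\<lambda>x. w x epowr a)"
proof (rule banach_function_norm.cube_average_pos[OF X Q])
  show "(\<lambda>x. w x epowr a) \<in> borel_measurable lebesgue"
    by (rule borel_measurable_epowr[OF w])
  show "AE x in lebesgue. x \<in> cube (fst Q) (snd Q) \<longrightarrow> 0 < w x epowr a"
    using pos by eventually_elim (simp add: epowr_pos)
qed

lemma le_weight_constant:
  assumes "0 < snd Q"
  shows "mean u (cube_of Q) epowr (1 / p) *
      (\<Prod>i = 1..m. cube_average (X i) (fst Q) (snd Q) (\<lambda>x. v i x epowr (- 1 / ps i)))
    \<le> weight_constant m p ps X u v"
  unfolding weight_constant_def cube_of_def using assms
  by (intro SUP_upper2[of Q]) (auto split: prod.split)

text \<open>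
  The averages of the \<open>v i\<close> are positive, so a vanishing constant forces \<open>u\<close> to have mean zero over
  every cube.
\<close>
lemma weight_constant_nonzero:
  assumes p: "0 < p" and X: "\<And>i. i \<in> {1..m} \<Longrightarrow> banach_function_norm (X i)"
    and v: "\<And>i. i \<in> {1..m} \<Longrightarrow> v i \<in> borel_measurable lebesgue"
    and v_pos: "\<And>i. i \<in> {1..m} \<Longrightarrow> AE x in lebesgue. 0 < v i x \<and> v i x < \<infinity>"
    and u: "u \<in> borel_measurable lebesgue" and u_ne: "\<not> (AE x in lebesgue. u x = 0)"
  shows "weight_constant m p ps X u v \<noteq> 0"
proof
  assume K: "weight_constant m p ps X u v = 0"
  have "mean u (cube_of Q) = 0" if Q: "0 < snd Q" for Q
  proof -
    have "(\<Prod>i = 1..m. cube_average (X i) (fst Q) (snd Q) (\<lambda>x. v i x epowr (- 1 / ps i))) \<noteq> 0"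
      using cube_average_weight_pos[OF X Q v v_pos] by (auto simp: zero_less_iff_neq_zero)
    then show ?thesis
      using le_weight_constant[OF Q, where u = u and p = p and m = m and X = X and v = v and ps = ps] p
      by (simp add: K epowr_eq_0_iff)
  qed
  with AE_zero_if_mean_zero[OF u] u_ne show False by blast
qed

section \<open>The multilinear maximal theorem\<close>

text \<open>
  The estimate away from the conventions for \<open>0\<close> and \<open>\<infinity>\<close>. Since \<open>u\<close> does not vanish on some cube
  \<open>Q\<^sub>0\<close>, the weight condition makes the averages of the \<open>v i\<close> finite on every cube containing \<open>Q\<^sub>0\<close>.
  As every cube lies in one of these, all \<open>f i\<close> are locally integrable, which the selection of a sparse
  family requires.
\<close>
lemma maximal_bound_nondegenerate:
  fixes X :: "nat \<Rightarrow> (real ^ 'n \<Rightarrow> ennreal) \<Rightarrow> ennreal" and u :: "real ^ 'n \<Rightarrow> ennreal"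
  assumes m: "1 \<le> m" and ps: "\<And>i. i \<in> {1..m} \<Longrightarrow> 1 < ps i"
    and sum_ps: "1 / p = (\<Sum>i = 1..m. 1 / ps i)"
    and X: "\<And>i. i \<in> {1..m} \<Longrightarrow> banach_function_norm (X i)"
    and N: "\<And>i. i \<in> {1..m} \<Longrightarrow> maximal_opnorm (associate (X i)) (ps i) < \<infinity>"
    and u [measurable]: "u \<in> borel_measurable lebesgue"
    and v: "\<And>i. i \<in> {1..m} \<Longrightarrow> v i \<in> borel_measurable lebesgue"
    and v_pos: "\<And>i. i \<in> {1..m} \<Longrightarrow> AE x in lebesgue. 0 < v i x \<and> v i x < \<infinity>"
    and K: "weight_constant m p ps X u v < \<infinity>"
    and f: "\<And>i. i \<in> {1..m} \<Longrightarrow> f i \<in> borel_measurable lebesgue"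
    and f_fin: "\<And>i. i \<in> {1..m} \<Longrightarrow> Lnorm (ps i) (v i) (modulus (f i)) < \<infinity>"
    and u_ne: "\<not> (AE x in lebesgue. u x = 0)"
  shows "Lnorm p u (multi_maximal m f) \<le>
    ennreal ((2 ^ CARD('n)) ^ m * (2 * 9 ^ CARD('n)) ^ m * (2 * 3 ^ CARD('n)) ^ m) *
    weight_constant m p ps X u v *
    (\<Prod>i = 1..m. maximal_opnorm (associate (X i)) (ps i) * Lnorm (ps i) (v i) (modulus (f i)))"
proof -
  let ?n = "CARD('n)"
  let ?K = "weight_constant m p ps X u v" and ?N = "\<lambda>i. maximal_opnorm (associate (X i)) (ps i)"
    and ?L = "\<lambda>i. Lnorm (ps i) (v i) (modulus (f i))"
  define h where "h i x = \<bar>f i x\<bar> * enn2real (v i x) powr (1 / ps i)" for i x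
  define W where "W i Q = cube_average (X i) (fst Q) (snd Q) (\<lambda>x. v i x epowr (- 1 / ps i))" for i and Q :: "'n cube_data"
  define G where "G i Q = cube_average (associate (X i)) (fst Q) (snd Q) (modulus (h i))" for i and Q :: "'n cube_data"
  define M where "M i = (\<integral>\<^sup>+x. maximal (associate (X i)) (modulus (h i)) x epowr ps i \<partial>lebesgue)" for i
  have ps0: "0 < ps i" if "i \<in> {1..m}" for i using ps[OF that] by simp
  have "0 < (\<Sum>i = 1..m. 1 / ps i)" using m ps0 by (intro sum_pos) auto
  then have p: "0 < p" using sum_ps by (metis zero_less_divide_1_iff)
  have p_le: "1 / p \<le> m"
  proof -
    have "(\<Sum>i = 1..m. 1 / ps i) \<le> (\<Sum>i = 1..m. 1)"
    proof (rule sum_mono)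
      fix i assume "i \<in> {1..m}"
      from ps[OF this] show "1 / ps i \<le> 1" by simp
    qed
    then show ?thesis unfolding sum_ps by simp
  qed
  have h: "h i \<in> borel_measurable lebesgue" if "i \<in> {1..m}" for i
    using f[OF that] v[OF that] unfolding h_def by measurable
  have h_norm: "Lnorm (ps i) (\<lambda>_. 1) (modulus (h i)) = ?L i"
    and h_eq: "AE x in lebesgue. modulus (f i) x = modulus (h i) x * v i x epowr (- 1 / ps i)"
    if "i \<in> {1..m}" for i
    using Lnorm_weight_transfer[OF ps0[OF that] v_pos[OF that], of "f i"] unfolding h_def by auto
  have M_le: "M i epowr (1 / ps i) \<le> ?N i * ?L i" if i: "i \<in> {1..m}" for i
  proof -
    have "M i epowr (1 / ps i) = Lnorm (ps i) (\<lambda>_. 1) (maximal (associate (X i)) (modulus (h i)))"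
      by (simp add: M_def Lnorm_def)
    also have "\<dots> \<le> ?N i * Lnorm (ps i) (\<lambda>_. 1) (modulus (h i))"
      by (rule Lnorm_maximal_le[OF h[OF i] N[OF i]]) (simp add: h_norm[OF i] f_fin[OF i, simplified])
    finally show ?thesis by (simp only: h_norm[OF i])
  qed
  have mean_le: "mean (modulus (f i)) (cube_of Q) \<le> G i Q * W i Q" if i: "i \<in> {1..m}" and Q: "0 < snd Q" for i Q
  proof -
    have "mean (modulus (f i)) (cube_of Q) = mean (\<lambda>x. modulus (h i) x * v i x epowr (- 1 / ps i)) (cube_of Q)"
      by (rule mean_cong_AE[OF h_eq[OF i]])
    also have "\<dots> \<le> G i Q * W i Q"
      unfolding G_def W_def cube_of_def
      by (rule banach_function_norm.mean_times_le_cube_averages[OF X[OF i] Q])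
         (use h[OF i] v[OF i] in \<open>auto intro: borel_measurable_epowr\<close>)
    finally show ?thesis .
  qed
  have K_ge: "mean u (cube_of Q) epowr (1 / p) * (\<Prod>i = 1..m. W i Q) \<le> ?K" if "0 < snd Q" for Q
    unfolding W_def by (rule le_weight_constant[OF that])
  have W_pos: "0 < W i Q" if i: "i \<in> {1..m}" and Q: "0 < snd Q" for i Q
    unfolding W_def by (rule cube_average_weight_pos[OF X[OF i] Q v[OF i] v_pos[OF i]])
  have packing: "(\<Sum>P\<in>S. emeasure lebesgue (E P) * G i (T P) epowr ps i) \<le> M i"
    if "i \<in> {1..m}" "finite S" "disjoint_family_on E S"
      "\<And>P. P \<in> S \<Longrightarrow> 0 < snd (T P) \<and> E P \<in> sets lebesgue \<and> E P \<subseteq> cube_of (T P)"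
    for i and S :: "'n cube_data set" and E T
    unfolding G_def M_def using that ps0[OF that(1)] by (intro sum_cube_average_le_maximal) auto
  have M_fin: "M i < \<infinity>" if i: "i \<in> {1..m}" for i
  proof -
    have "?N i * ?L i < \<infinity>" using N[OF i] f_fin[OF i] by (simp add: ennreal_mult_less_top)
    with M_le[OF i] have "M i epowr (1 / ps i) < \<infinity>" by (rule le_less_trans)
    then show ?thesis using ps0[OF i] by (simp add: epowr_less_top_iff)
  qed
  have G_fin: "G i Q < \<infinity>" if i: "i \<in> {1..m}" and Q: "0 < snd Q" for i Q
  proof -
    have "emeasure lebesgue (cube_of Q) * G i Q epowr ps i \<le> M i"
      using packing[OF i, of "{Q}" cube_of "\<lambda>Q. Q"] Q by (simp add: disjoint_family_on_def)
    then have "emeasure lebesgue (cube_of Q) * G i Q epowr ps i < \<infinity>"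
      using M_fin[OF i] by (rule le_less_trans)
    then show ?thesis
      using Q ps0[OF i] by (auto simp: emeasure_cube_of ennreal_mult_less_top epowr_less_top_iff epowr_eq_0_iff)
  qed
  obtain Q0 :: "'n cube_data" where Q0: "0 < snd Q0" "mean u (cube_of Q0) \<noteq> 0"
    using AE_zero_if_mean_zero[OF u] u_ne by blast
  have finite_mean: "mean (modulus (f i)) (cube_of Q) < \<infinity>" if i: "i \<in> {1..m}" and Q: "0 < snd Q" for i Q
  proof -
    obtain R where R: "0 < snd R" "cube_of Q \<subseteq> cube_of R" "cube_of Q0 \<subseteq> cube_of R"
      by (rule cube_containing_two_cubes[OF Q Q0(1)])
    have u_R: "0 < mean u (cube_of R)"
    proof -
      have "mean u (cube_of Q0) \<le> (emeasure lebesgue (cube_of R) / emeasure lebesgue (cube_of Q0)) * mean u (cube_of R)"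
        using Q0 R by (intro mean_le_scaled_mean) (auto simp: emeasure_cube_of divide_ennreal ennreal_mult[symmetric])
      then show ?thesis using Q0(2) by (auto simp: zero_less_iff_neq_zero)
    qed
    have "mean u (cube_of R) epowr (1 / p) * (\<Prod>i = 1..m. W i R) < \<infinity>"
      using K_ge[OF R(1)] K by (rule le_less_trans)
    moreover have "mean u (cube_of R) epowr (1 / p) \<noteq> 0"
      using u_R p by (simp add: epowr_eq_0_iff)
    moreover have "(\<Prod>i = 1..m. W i R) \<noteq> 0"
      using W_pos[OF _ R(1)] by (auto simp: zero_less_iff_neq_zero)
    ultimately have "(\<Prod>i = 1..m. W i R) < \<infinity>"
      unfolding ennreal_mult_less_top infinity_ennreal_def by blast
    moreover have "W j R \<noteq> 0" if "j \<in> {1..m}" for j using W_pos[OF that R(1)] by simp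
    ultimately have "W i R < \<infinity>"
      using i unfolding infinity_ennreal_def less_top[symmetric] ennreal_prod_eq_top by blast
    then have "mean (modulus (f i)) (cube_of R) < \<infinity>"
      using mean_le[OF i R(1)] G_fin[OF i R(1)] by (auto simp: ennreal_mult_less_top intro: le_less_trans)
    then have "(emeasure lebesgue (cube_of R) / emeasure lebesgue (cube_of Q)) * mean (modulus (f i)) (cube_of R) < \<infinity>"
      using Q R by (auto simp: emeasure_cube_of divide_ennreal ennreal_mult_less_top)
    moreover have "mean (modulus (f i)) (cube_of Q)
        \<le> (emeasure lebesgue (cube_of R) / emeasure lebesgue (cube_of Q)) * mean (modulus (f i)) (cube_of R)"
      using Q R by (intro mean_le_scaled_mean) (auto simp: emeasure_cube_of divide_ennreal ennreal_mult[symmetric])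
    ultimately show ?thesis by (rule le_less_trans[rotated])
  qed
  let ?A = "mean_product m (\<lambda>i. modulus (f i))"
  have finite_mean_product: "?A Q < \<infinity>" if "0 < snd Q" for Q
    using finite_mean[OF _ that] by (simp add: mean_product_def less_top[symmetric] ennreal_prod_eq_top)
  have mf: "modulus (f i) \<in> borel_measurable lebesgue" if "i \<in> {1..m}" for i
    using f[OF that] by measurable
  let ?c = "ennreal ((2 ^ ?n) ^ m)" and ?\<kappa> = "ennreal ((2 * 9 ^ ?n) ^ m)"
  let ?B = "?\<kappa> epowr p * (2 * 3 ^ ?n) * ?K epowr p * (\<Prod>i = 1..m. M i epowr (p / ps i))"
  have term_measurable: "(\<lambda>x. ?A Q epowr p * indicator (cube_of Q) x) \<in> borel_measurable lebesgue" for Q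
    by (rule borel_measurable_times_ennreal[OF borel_measurable_const borel_measurable_indicator[OF cube_of_measurable]])
  have "(\<integral>\<^sup>+x. multi_maximal m f x epowr p * u x \<partial>lebesgue)
      \<le> (\<integral>\<^sup>+x. ?c epowr p * ((SUP R\<in>rational_cubes. ?A R epowr p * indicator (cube_of R) x) * u x) \<partial>lebesgue)"
    using mult_right_mono[OF multi_maximal_epowr_le[OF p] zero_le]
    by (intro nn_integral_mono) (simp only: mult.assoc)
  also have "\<dots> = ?c epowr p * (\<integral>\<^sup>+x. (SUP R\<in>rational_cubes. ?A R epowr p * indicator (cube_of R) x) * u x \<partial>lebesgue)"
    by (rule nn_integral_cmult[OF borel_measurable_times_ennreal[OF
          borel_measurable_SUP[OF countable_rational_cubes term_measurable] u]])
  also have "\<dots> \<le> ?c epowr p * ?B"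
  proof (rule mult_left_mono, rule nn_integral_countable_SUP_le[OF countable_rational_cubes term_measurable u])
    fix F :: "'n cube_data set" assume F: "finite F" "F \<subseteq> rational_cubes"
    have "0 < snd Q" if "Q \<in> F" for Q using F(2) that by (auto simp: rational_cubes_def)
    then show "(\<integral>\<^sup>+x. (SUP Q\<in>F. ?A Q epowr p * indicator (cube_of Q) x) * u x \<partial>lebesgue) \<le> ?B"
      by (rule finite_family_maximal_bound[where W = W and G = G,
            OF m F(1) _ p ps0 sum_ps u mf finite_mean_product mean_le K_ge])
         (auto intro!: packing)
  qed simp
  finally have "Lnorm p u (multi_maximal m f) \<le> (?c epowr p * ?B) epowr (1 / p)"
    unfolding Lnorm_def using p by (intro epowr_mono) auto
  also have "\<dots> = ?c * ?\<kappa> * (2 * 3 ^ ?n) epowr (1 / p) * ?K * (\<Prod>i = 1..m. M i epowr (1 / ps i))"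
  proof -
    have "(M i epowr (p / ps i)) epowr (1 / p) = M i epowr (1 / ps i)" if "i \<in> {1..m}" for i
      using p ps0[OF that] by (subst epowr_epowr) auto
    then have "(\<Prod>i = 1..m. M i epowr (p / ps i)) epowr (1 / p) = (\<Prod>i = 1..m. M i epowr (1 / ps i))"
      using p by (subst epowr_prod) auto
    then show ?thesis
      using p by (simp add: epowr_mult epowr_epowr mult_ac)
  qed
  also have "\<dots> \<le> ?c * ?\<kappa> * ennreal ((2 * 3 ^ ?n) ^ m) * ?K * (\<Prod>i = 1..m. ?N i * ?L i)"
  proof (intro mult_mono order_refl prod_mono_ennreal M_le)
    have one: "(1::real) \<le> 2 * 3 ^ ?n" using one_le_power[of "3::real" ?n] by linarith
    have "(2 * 3 ^ ?n :: ennreal) = ennreal (2 * 3 ^ ?n)"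
      by (simp add: ennreal_mult ennreal_power[symmetric])
    then have "(2 * 3 ^ ?n :: ennreal) epowr (1 / p) = ennreal ((2 * 3 ^ ?n) powr (1 / p))"
      using p by (simp only: ennreal_epowr) (simp add: ennreal_epowr)
    also have "\<dots> \<le> ennreal ((2 * 3 ^ ?n) powr real m)"
      using p_le one by (intro ennreal_leI powr_mono)
    also have "(2 * 3 ^ ?n :: real) powr real m = (2 * 3 ^ ?n) ^ m"
      using one by (subst powr_realpow) auto
    finally show "(2 * 3 ^ ?n :: ennreal) epowr (1 / p) \<le> ennreal ((2 * 3 ^ ?n) ^ m)" .
  qed auto
  also have "?c * ?\<kappa> * ennreal ((2 * 3 ^ ?n) ^ m) = ennreal ((2 ^ ?n) ^ m * (2 * 9 ^ ?n) ^ m * (2 * 3 ^ ?n) ^ m)"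
    by (subst ennreal_mult[symmetric], simp, simp)+ (rule refl)
  finally show ?thesis .
qed

theorem theorem1p3:
  fixes m :: nat
  assumes "1 \<le> m"
  shows "\<exists>C::real. 0 < C \<and>
    (\<forall>(ps :: nat \<Rightarrow> real) (p :: real) (X :: nat \<Rightarrow> (real ^ 'n \<Rightarrow> ennreal) \<Rightarrow> ennreal)
       (u :: real ^ 'n \<Rightarrow> ennreal) (v :: nat \<Rightarrow> real ^ 'n \<Rightarrow> ennreal).
       (\<forall>i\<in>{1..m}. 1 < ps i) \<longrightarrow>
       1 / p = (\<Sum>i = 1..m. 1 / ps i) \<longrightarrow>
       (\<forall>i\<in>{1..m}. banach_function_norm (X i)) \<longrightarrow>
       (\<forall>i\<in>{1..m}. maximal_opnorm (associate (X i)) (ps i) < \<infinity>) \<longrightarrow>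
       u \<in> borel_measurable lebesgue \<longrightarrow>
       (\<forall>i\<in>{1..m}. v i \<in> borel_measurable lebesgue \<and>
          (AE x in lebesgue. 0 < v i x \<and> v i x < \<infinity>)) \<longrightarrow>
       weight_constant m p ps X u v < \<infinity> \<longrightarrow>
       (\<forall>f :: nat \<Rightarrow> real ^ 'n \<Rightarrow> real.
          (\<forall>i\<in>{1..m}. f i \<in> borel_measurable lebesgue) \<longrightarrow>
          Lnorm p u (multi_maximal m f)
            \<le> ennreal C * weight_constant m p ps X u v *
               (\<Prod>i = 1..m. maximal_opnorm (associate (X i)) (ps i) *
                  Lnorm (ps i) (v i) (modulus (f i)))))"
proof (intro exI[of _ "(2 ^ CARD('n)) ^ m * (2 * 9 ^ CARD('n)) ^ m * (2 * 3 ^ CARD('n)) ^ m :: real"]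
    conjI allI impI)
  let ?C = "(2 ^ CARD('n)) ^ m * (2 * 9 ^ CARD('n)) ^ m * (2 * 3 ^ CARD('n)) ^ m :: real"
  show C: "0 < ?C" by (intro mult_pos_pos zero_less_power) auto
  fix ps :: "nat \<Rightarrow> real" and p :: real and X :: "nat \<Rightarrow> (real ^ 'n \<Rightarrow> ennreal) \<Rightarrow> ennreal"
    and u :: "real ^ 'n \<Rightarrow> ennreal" and v :: "nat \<Rightarrow> real ^ 'n \<Rightarrow> ennreal"
    and f :: "nat \<Rightarrow> real ^ 'n \<Rightarrow> real"
  let ?K = "weight_constant m p ps X u v" and ?N = "\<lambda>i. maximal_opnorm (associate (X i)) (ps i)"
    and ?L = "\<lambda>i. Lnorm (ps i) (v i) (modulus (f i))"
  assume "\<forall>i\<in>{1..m}. 1 < ps i" and sum_ps: "1 / p = (\<Sum>i = 1..m. 1 / ps i)"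
    and "\<forall>i\<in>{1..m}. banach_function_norm (X i)"
    and "\<forall>i\<in>{1..m}. maximal_opnorm (associate (X i)) (ps i) < \<infinity>"
    and u: "u \<in> borel_measurable lebesgue"
    and "\<forall>i\<in>{1..m}. v i \<in> borel_measurable lebesgue \<and>
          (AE x in lebesgue. 0 < v i x \<and> v i x < \<infinity>)"
    and K: "?K < \<infinity>"
    and "\<forall>i\<in>{1..m}. f i \<in> borel_measurable lebesgue"
  then have ps: "1 < ps i" and X: "banach_function_norm (X i)" and N: "?N i < \<infinity>"
    and v: "v i \<in> borel_measurable lebesgue"
    and v_pos: "AE x in lebesgue. 0 < v i x \<and> v i x < \<infinity>"
    and f: "f i \<in> borel_measurable lebesgue" if "i \<in> {1..m}" for i
    using that by blast+
  have ps0: "0 < ps i" if "i \<in> {1..m}" for i using ps[OF that] by simp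
  have "0 < (\<Sum>i = 1..m. 1 / ps i)" using assms ps0 by (intro sum_pos) auto
  then have p: "0 < p" using sum_ps by (metis zero_less_divide_1_iff)
  \<comment> \<open>If \<open>u\<close> or some \<open>f i\<close> vanishes almost everywhere, the left-hand side is zero. If some norm is infinite
    while none is zero, the right-hand side is infinite, because \<open>?K\<close> and the operator norms are positive.\<close>
  consider "AE x in lebesgue. u x = 0"
    | i where "i \<in> {1..m}" "?L i = 0"
    | i where "i \<in> {1..m}" "?L i = \<infinity>" "\<And>i. i \<in> {1..m} \<Longrightarrow> ?L i \<noteq> 0" "\<not> (AE x in lebesgue. u x = 0)"
    | "\<And>i. i \<in> {1..m} \<Longrightarrow> ?L i < \<infinity>" "\<not> (AE x in lebesgue. u x = 0)"
    unfolding infinity_ennreal_def less_top[symmetric] by metis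
  then show "Lnorm p u (multi_maximal m f) \<le> ennreal ?C * ?K * (\<Prod>i = 1..m. ?N i * ?L i)"
  proof cases
    case 1
    then show ?thesis by (simp add: Lnorm_zero_weight[OF p])
  next
    case (2 i)
    have "AE x in lebesgue. modulus (f i) x = 0"
      by (rule Lnorm_eq_0_imp_AE_zero[OF ps0[OF 2(1)] _ v[OF 2(1)] _ 2(2)])
         (use f[OF 2(1)] v_pos[OF 2(1)] in \<open>auto elim: eventually_mono\<close>)
    then have "AE x in lebesgue. f i x = 0" by simp
    then have "multi_maximal m f x = 0" for x
      by (rule multi_maximal_eq_0[where f = f, OF 2(1)])
    then show ?thesis
      using p by (simp add: Lnorm_def)
  next
    case (3 i)
    have "?K \<noteq> 0"
      by (rule weight_constant_nonzero[OF p X v v_pos u 3(4)])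
    have "?N j * ?L j \<noteq> 0" if j: "j \<in> {1..m}" for j
      using banach_function_norm.maximal_opnorm_associate_pos[OF X[OF j] ps0[OF j]] 3(3)[OF j] by auto
    moreover have "?N i * ?L i = \<infinity>"
      using banach_function_norm.maximal_opnorm_associate_pos[OF X[OF 3(1)] ps0[OF 3(1)]] 3(2)
      by (auto simp: ennreal_mult_top)
    ultimately have "(\<Prod>i = 1..m. ?N i * ?L i) = \<infinity>"
      using 3(1) unfolding infinity_ennreal_def by (subst ennreal_prod_eq_top) blast
    moreover have "ennreal ?C * ?K \<noteq> 0"
      using C \<open>?K \<noteq> 0\<close> unfolding mult_eq_0_iff ennreal_eq_0_iff de_Morgan_disj not_le by blast
    ultimately show ?thesis by (simp only: infinity_ennreal_def ennreal_mult_top simp_thms if_False top_greatest)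
  next
    case 4
    then show ?thesis
      by (intro maximal_bound_nondegenerate assms ps sum_ps X N u v v_pos K f)
  qed
qed

end
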